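(* Let $q<0$, let $Q$ be a star body in $\mathbb{R}^n$, and let $\mu$ be a finite Borel measure on $\mathbb{S}^{n-1}$. Then there exists a convex body $K$ in $\mathbb{R}^n$ containing the origin in its interior such that $\widetilde{C}_q(K,Q,\cdot)=\mu$ if and only if $\mu$ is not concentrated in any closed hemisphere of $\mathbb{S}^{n-1}$.
   Context: $\mathbb{S}^{n-1}$ is the unit sphere of $\mathbb{R}^n$ and $du$ is the standard surface measure on it. A star body is a compact set $Q\subset\mathbb{R}^n$, star-shaped with respect to the origin (the segment joining any point of $Q$ to the origin lies in $Q$), whose radial function $\rho_Q(u)=\max\{\lambda:\lambda u\in Q\}$, $u\in\mathbb{S}^{n-1}$, is positive and continuous. A convex body is a compact convex set with non-empty interior. A closed hemisphere is a set $\{x\in\mathbb{S}^{n-1}:x\cdot v\ge 0\}$ with $v\in\mathbb{S}^{n-1}$; $\mu$ is concentrated in a Borel set $S$ if $\mu(\mathbb{S}^{n-1}\setminus S)=0$. For $q\in\mathbb{R}$, a star body $Q$, and a convex body $K$ containing the origin in its interior, the generalized $q$-th dual curvature measure is the Borel measure on $\mathbb{S}^{n-1}$ $$\widetilde{C}_q(K,Q,\eta)=\frac1n\int_{\boldsymbol{\alpha}_K^*(\eta)}\rho_K^q(u)\rho_Q^{n-q}(u)\,du,\qquad \eta\subset\mathbb{S}^{n-1}\text{ Borel},$$ where $\boldsymbol{\alpha}_K^*(\eta)=\{u\in\mathbb{S}^{n-1}:\rho_K(u)u\in\nu_K^{-1}(\eta)\}$ and $\nu_K^{-1}(\eta)$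 is the set of boundary points of $K$ having an outer unit normal vector belonging to $\eta$. *)

theory Defs
  imports "HOL-Analysis.Analysis"
begin

section \<open>Surface measure on the unit sphere\<close>

text \<open>
  The surface measure is defined through polar coordinates: a Borel set \<open>A\<close> of unit vectors has
  measure \<open>n\<close> times the Lebesgue measure of the punctured cone \<open>{r u | u \<in> A, 0 < r \<le> 1}\<close>.  For
  \<open>n = 1\<close> this is the counting measure on the two unit vectors.
\<close>

definition sphere_measure :: "'a::euclidean_space measure" where
  "sphere_measure =
     scale_measure (of_nat DIM('a))
       (distr (restrict_space lborel (cball 0 1 - {0})) (restrict_space borel (sphere 0 1))
          (\<lambda>x. x /\<^sub>R norm x))"

lemma measurable_normalize:
  "(\<lambda>x. x /\<^sub>R norm x) \<in>
     restrict_space lborel (cball 0 1 - {0}) \<rightarrow>\<^sub>M restrict_space borel (sphere (0::'a::euclidean_space) 1)"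
proof (rule measurable_restrict_space2)
  show "(\<lambda>x. x /\<^sub>R norm x) \<in> restrict_space lborel (cball (0::'a) 1 - {0}) \<rightarrow>\<^sub>M borel"
    by (rule measurable_restrict_space1) measurable
qed (auto simp: space_restrict_space)

lemma sets_sphere_measure: "sets sphere_measure = sets (restrict_space borel (sphere 0 1))"
  by (simp add: sphere_measure_def)

lemma emeasure_sphere_measure:
  assumes "A \<in> sets borel" "A \<subseteq> sphere (0::'a::euclidean_space) 1"
  shows "emeasure sphere_measure A =
    of_nat DIM('a) * emeasure lborel {x \<in> cball 0 1 - {0}. x /\<^sub>R norm x \<in> A}"
proof -
  have A: "A \<in> sets (restrict_space borel (sphere 0 1))"
    using assms by (simp add: sets_restrict_space_iff)
  have "(\<lambda>x. x /\<^sub>R norm x) -` A \<inter> space (restrict_space lborel (cball 0 1 - {0}))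
      = {x \<in> cball 0 1 - {0}. x /\<^sub>R norm x \<in> A}"
    by (auto simp: space_restrict_space)
  with A show ?thesis
    by (subst sphere_measure_def)
       (simp add: emeasure_distr[OF measurable_normalize A] emeasure_restrict_space subset_iff)
qed

section \<open>Star bodies and convex bodies\<close>

text \<open>The maximum is attained for every \<open>u \<noteq> 0\<close> when \<open>Q\<close> is compact and contains the origin.\<close>

definition radial_fun :: "'a::euclidean_space set \<Rightarrow> 'a \<Rightarrow> real" where
  "radial_fun Q u = (GREATEST t. t *\<^sub>R u \<in> Q)"

text \<open>
  The condition \<open>0 \<in> Q\<close> only excludes the empty set, for which \<open>radial_fun\<close> is meaningless.
\<close>

definition star_body :: "'a::euclidean_space set \<Rightarrow> bool" where
  "star_body Q \<longleftrightarrow>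
     compact Q \<and> 0 \<in> Q \<and> (\<forall>x\<in>Q. closed_segment 0 x \<subseteq> Q) \<and>
     (\<forall>u\<in>sphere 0 1. radial_fun Q u > 0) \<and> continuous_on (sphere 0 1) (radial_fun Q)"

definition convex_body :: "'a::euclidean_space set \<Rightarrow> bool" where
  "convex_body K \<longleftrightarrow> compact K \<and> convex K \<and> interior K \<noteq> {}"

section \<open>Generalized dual curvature measures\<close>

definition outer_unit_normal :: "'a::euclidean_space set \<Rightarrow> 'a \<Rightarrow> 'a \<Rightarrow> bool" where
  "outer_unit_normal K x v \<longleftrightarrow> norm v = 1 \<and> (\<forall>y\<in>K. y \<bullet> v \<le> x \<bullet> v)"

definition reverse_gauss_image :: "'a::euclidean_space set \<Rightarrow> 'a set \<Rightarrow> 'a set" where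
  "reverse_gauss_image K \<eta> = {x \<in> frontier K. \<exists>v\<in>\<eta>. outer_unit_normal K x v}"

definition reverse_radial_gauss_image :: "'a::euclidean_space set \<Rightarrow> 'a set \<Rightarrow> 'a set" where
  "reverse_radial_gauss_image K \<eta> =
     {u \<in> sphere 0 1. radial_fun K u *\<^sub>R u \<in> reverse_gauss_image K \<eta>}"

text \<open>
  For a Borel set \<open>\<eta>\<close> the set \<open>reverse_radial_gauss_image K \<eta>\<close> is measurable for the completed
  surface measure, but it need not be Borel; hence the completion.
\<close>

definition dual_curvature_measure ::
    "real \<Rightarrow> 'a::euclidean_space set \<Rightarrow> 'a set \<Rightarrow> 'a set \<Rightarrow> ennreal" where
  "dual_curvature_measure q K Q \<eta> =
     ennreal (1 / real DIM('a)) *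
     (\<integral>\<^sup>+ u\<in>reverse_radial_gauss_image K \<eta>.
        ennreal (radial_fun K u powr q * radial_fun Q u powr (real DIM('a) - q))
      \<partial>completion sphere_measure)"

section \<open>Concentration on hemispheres\<close>

definition closed_hemisphere :: "'a::euclidean_space \<Rightarrow> 'a set" where
  "closed_hemisphere v = {x \<in> sphere 0 1. x \<bullet> v \<ge> 0}"

definition concentrated_in :: "'a::euclidean_space measure \<Rightarrow> 'a set \<Rightarrow> bool" where
  "concentrated_in \<mu> S \<longleftrightarrow> emeasure \<mu> (sphere 0 1 - S) = 0"

end

theory Submission
  imports Defs "HOL-Complex_Analysis.Great_Picard" "HOL-Real_Asymp.Real_Asymp"
begin

text \<open>
  Necessity: if \<open>r B \<subseteq> K \<subseteq> R B\<close>, then near the direction \<open>-v\<close> all normals of \<open>K\<close> lie in the open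
  hemisphere opposite to \<open>v\<close>, so that this hemisphere has positive measure.

  Sufficiency is variational.  Put \<open>p = -q > 0\<close>.  A positive continuous function \<open>g\<close> on the sphere
  has the Wulff shape \<open>{x. \<forall>v. x \<bullet> v \<le> g v}\<close>, whose gauge is \<open>h(x) = max\<^sub>v (x \<bullet> v) / g v\<close> and whose
  radial function is \<open>1 / h\<close>.  One minimizes
  \<open>(1 / p) \<integral> h\<^sup>p w du + \<integral> ln g d\<mu>\<close> with \<open>w = \<rho>\<^sub>Q\<^bsup>n - q\<^esup> / n\<close>.
  Replacing \<open>g\<close> by the support function of its Wulff shape does not increase this energy, and neither
  term can compensate for a degenerating shape because neither the surface measure nor \<open>\<mu>\<close> is
  concentrated in a hemisphere; so Arzela-Ascoli yields a minimizer.  The gauge \<open>h\<close> is convex, hence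
  has a unique subgradient in almost every direction \<open>u\<close>, i.e. a unique maximizer \<open>N u\<close> in its
  definition.  Differentiating the energy along \<open>g e\<^bsup>-t\<psi>\<^esup>\<close> at \<open>t = 0\<close> gives
  \<open>\<integral> h\<^sup>p w (\<psi> \<circ> N) du = \<integral> \<psi> d\<mu>\<close>, which says that the dual curvature measure of the Wulff shape
  is \<open>\<mu>\<close>.
\<close>

section \<open>Gauges of Wulff shapes\<close>

abbreviation (input) usphere :: "'a::euclidean_space set" where "usphere \<equiv> sphere 0 1"

definition pos_cont :: "('a::euclidean_space \<Rightarrow> real) \<Rightarrow> bool" where
  "pos_cont g \<longleftrightarrow> continuous_on usphere g \<and> (\<forall>v\<in>usphere. 0 < g v)"

text \<open>For positive continuous \<open>g\<close> this is the support function of the set of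
  points \<open>v / g v\<close>, hence sublinear. Only the values of \<open>g\<close> on the sphere
  matter. Applied twice, it gives the support function of the Wulff shape of
  \<open>g\<close>.\<close>

definition wulff_gauge :: "('a::euclidean_space \<Rightarrow> real) \<Rightarrow> 'a \<Rightarrow> real" where
  "wulff_gauge g x = (SUP v\<in>usphere. (x \<bullet> v) / g v)"

lemma usphere_nonempty: "usphere \<noteq> ({} :: 'a::euclidean_space set)"
  by simp

lemma pos_contD: "pos_cont g \<Longrightarrow> v \<in> usphere \<Longrightarrow> 0 < g v"
  by (simp add: pos_cont_def)

lemma pos_cont_attains_min:
  assumes "pos_cont g"
  obtains v where "v \<in> usphere" "\<And>u. u \<in> usphere \<Longrightarrow> g v \<le> g u"
  using continuous_attains_inf[OF compact_sphere usphere_nonempty, of g] assms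
  by (auto simp: pos_cont_def)

lemma pos_cont_attains_max:
  assumes "pos_cont g"
  obtains v where "v \<in> usphere" "\<And>u. u \<in> usphere \<Longrightarrow> g u \<le> g v"
  using continuous_attains_sup[OF compact_sphere usphere_nonempty, of g] assms
  by (auto simp: pos_cont_def)

lemma pos_cont_lower:
  assumes "pos_cont g"
  obtains a where "0 < a" "\<And>u. u \<in> usphere \<Longrightarrow> a \<le> g u"
  by (metis pos_cont_attains_min[OF assms] pos_contD[OF assms])

lemma pos_cont_upper:
  assumes "pos_cont g"
  obtains b where "0 < b" "\<And>u. u \<in> usphere \<Longrightarrow> g u \<le> b"
  by (metis pos_cont_attains_max[OF assms] pos_contD[OF assms])

lemma wulff_gauge_attained_upper:
  assumes "pos_cont g"
  obtains v where "v \<in> usphere" "wulff_gauge g x = (x \<bullet> v) / g v"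
    "\<And>u. u \<in> usphere \<Longrightarrow> (x \<bullet> u) / g u \<le> (x \<bullet> v) / g v"
proof -
  have "continuous_on usphere (\<lambda>v. (x \<bullet> v) / g v)"
    using assms by (intro continuous_intros) (auto simp: pos_cont_def dest: less_imp_neq)
  then obtain v where v: "v \<in> usphere" "\<And>u. u \<in> usphere \<Longrightarrow> (x \<bullet> u) / g u \<le> (x \<bullet> v) / g v"
    using continuous_attains_sup[OF compact_sphere usphere_nonempty] by blast
  have "wulff_gauge g x = (x \<bullet> v) / g v"
    unfolding wulff_gauge_def by (rule cSup_eq_maximum) (use v in auto)
  with v that show thesis by blast
qed

lemma wulff_gauge_upper:
  assumes "pos_cont g" "u \<in> usphere"
  shows "(x \<bullet> u) / g u \<le> wulff_gauge g x"
  by (metis assms wulff_gauge_attained_upper)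

lemma wulff_gauge_attained:
  assumes "pos_cont g"
  obtains v where "v \<in> usphere" "wulff_gauge g x = (x \<bullet> v) / g v"
  by (metis assms wulff_gauge_attained_upper)

lemma wulff_gauge_scale:
  assumes "pos_cont g" "0 \<le> c"
  shows "wulff_gauge g (c *\<^sub>R x) = c * wulff_gauge g x"
proof (rule antisym)
  obtain v where "v \<in> usphere" "wulff_gauge g (c *\<^sub>R x) = ((c *\<^sub>R x) \<bullet> v) / g v"
    using wulff_gauge_attained assms by metis
  then show "wulff_gauge g (c *\<^sub>R x) \<le> c * wulff_gauge g x"
    using mult_left_mono[OF wulff_gauge_upper[OF assms(1), of v x] assms(2)] by simp
  obtain v where "v \<in> usphere" "wulff_gauge g x = (x \<bullet> v) / g v"
    using wulff_gauge_attained assms by metis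
  then show "c * wulff_gauge g x \<le> wulff_gauge g (c *\<^sub>R x)"
    using wulff_gauge_upper[OF assms(1), of v "c *\<^sub>R x"] by simp
qed

lemma wulff_gauge_0 [simp]: "pos_cont g \<Longrightarrow> wulff_gauge g 0 = 0"
  using wulff_gauge_scale[of g 0 0] by simp

lemma wulff_gauge_triangle:
  assumes "pos_cont g"
  shows "wulff_gauge g (x + y) \<le> wulff_gauge g x + wulff_gauge g y"
proof -
  obtain v where "v \<in> usphere" "wulff_gauge g (x + y) = ((x + y) \<bullet> v) / g v"
    using wulff_gauge_attained assms by metis
  then show ?thesis
    using wulff_gauge_upper[OF assms, of v x] wulff_gauge_upper[OF assms, of v y]
    by (simp add: inner_add_left add_divide_distrib)
qed

lemma wulff_gauge_le:
  assumes "pos_cont g" "0 < a" "\<And>u. u \<in> usphere \<Longrightarrow> a \<le> g u"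
  shows "wulff_gauge g x \<le> norm x / a"
proof -
  obtain v where v: "v \<in> usphere" "wulff_gauge g x = (x \<bullet> v) / g v"
    using wulff_gauge_attained assms by metis
  have "x \<bullet> v \<le> norm x"
    using norm_cauchy_schwarz[of x v] v by simp
  then have "(x \<bullet> v) / g v \<le> norm x / g v"
    using pos_contD[OF assms(1) v(1)] by (simp add: divide_right_mono)
  also have "\<dots> \<le> norm x / a"
    using assms(2,3) v pos_contD[OF assms(1) v(1)] by (intro divide_left_mono) auto
  finally show ?thesis using v by simp
qed

lemma wulff_gauge_ge:
  assumes "pos_cont g" "\<And>u. u \<in> usphere \<Longrightarrow> g u \<le> b"
  shows "norm x / b \<le> wulff_gauge g x"
proof (cases "x = 0")
  case False
  let ?v = "x /\<^sub>R norm x"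
  have v: "?v \<in> usphere" using False by simp
  have "norm x / b \<le> norm x / g ?v"
    using assms(2)[OF v] pos_contD[OF assms(1) v] by (intro divide_left_mono) auto
  also have "\<dots> = (x \<bullet> ?v) / g ?v"
    using False by (simp add: dot_square_norm power2_eq_square)
  also have "\<dots> \<le> wulff_gauge g x"
    using wulff_gauge_upper[OF assms(1) v] .
  finally show ?thesis .
qed (use assms in simp)

lemma wulff_gauge_pos:
  assumes "pos_cont g" "x \<noteq> 0"
  shows "0 < wulff_gauge g x"
proof -
  obtain b where b: "0 < b" "\<And>u. u \<in> usphere \<Longrightarrow> g u \<le> b"
    using pos_cont_upper[OF assms(1)] by metis
  have "0 < norm x / b" using b assms by simp
  then show ?thesis using wulff_gauge_ge[OF assms(1) b(2), of x] by linarith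
qed

text \<open>Subadditivity turns the upper bound of the gauge into a Lipschitz constant. It depends
  only on the lower bound \<open>a\<close>, which later makes minimizing sequences
  equicontinuous.\<close>

lemma wulff_gauge_lipschitz:
  assumes "pos_cont g" "0 < a" "\<And>u. u \<in> usphere \<Longrightarrow> a \<le> g u"
  shows "\<bar>wulff_gauge g x - wulff_gauge g y\<bar> \<le> norm (x - y) / a"
  using wulff_gauge_triangle[OF assms(1), of "x - y" y] wulff_gauge_triangle[OF assms(1), of "y - x" x]
    wulff_gauge_le[OF assms, of "x - y"] wulff_gauge_le[OF assms, of "y - x"]
  by (simp add: norm_minus_commute abs_le_iff)

lemma continuous_on_wulff_gauge:
  assumes "pos_cont g"
  shows "continuous_on A (wulff_gauge g)"
proof -
  obtain a where a: "0 < a" "\<And>u. u \<in> usphere \<Longrightarrow> a \<le> g u"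
    using pos_cont_lower[OF assms] by metis
  have "(1/a)-lipschitz_on A (wulff_gauge g)"
    using a wulff_gauge_lipschitz[OF assms a] by (intro lipschitz_onI) (auto simp: dist_norm)
  then show ?thesis by (rule lipschitz_on_continuous_on)
qed

lemma pos_cont_wulff_gauge:
  assumes "pos_cont g"
  shows "pos_cont (wulff_gauge g)"
  unfolding pos_cont_def
proof
  show "\<forall>v\<in>usphere. 0 < wulff_gauge g v"
    using wulff_gauge_pos[OF assms] by (metis mem_sphere_0 norm_zero zero_neq_one)
qed (rule continuous_on_wulff_gauge[OF assms])

text \<open>The double gauge is the support function of the Wulff shape, and that shape lies in
  every half-space \<open>x \<bullet> v \<le> g v\<close>.\<close>

lemma wulff_gauge_twice_le:
  assumes "pos_cont g" "v \<in> usphere"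
  shows "wulff_gauge (wulff_gauge g) v \<le> g v"
proof -
  obtain u where u: "u \<in> usphere" "wulff_gauge (wulff_gauge g) v = (v \<bullet> u) / wulff_gauge g u"
    using wulff_gauge_attained[OF pos_cont_wulff_gauge[OF assms(1)]] by metis
  have "(u \<bullet> v) / g v \<le> wulff_gauge g u" by (rule wulff_gauge_upper[OF assms])
  then show ?thesis
    using u pos_contD[OF assms] pos_contD[OF pos_cont_wulff_gauge[OF assms(1)] u(1)]
    by (simp add: pos_divide_le_eq inner_commute mult.commute)
qed

section \<open>Finite measures on the sphere\<close>

locale usphere_measure = finite_measure M for M :: "'a::euclidean_space measure" +
  assumes sets_M: "sets M = sets (restrict_space borel usphere)"
begin

lemma space_M: "space M = usphere"
  using sets_eq_imp_space_eq[OF sets_M] by (simp add: space_restrict_space)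

lemma borel_measurable_continuous:
  fixes f :: "'a \<Rightarrow> 'b::topological_space"
  assumes "continuous_on usphere f"
  shows "f \<in> borel_measurable M"
  using borel_measurable_continuous_on_restrict[OF assms] measurable_cong_sets[OF sets_M refl] by blast

lemma integrable_continuous:
  fixes f :: "'a \<Rightarrow> real"
  assumes "continuous_on usphere f"
  shows "integrable M f"
proof -
  have "bounded (f ` usphere)"
    using compact_continuous_image[OF assms compact_sphere] compact_imp_bounded by blast
  then obtain B where "\<And>v. v \<in> usphere \<Longrightarrow> norm (f v) \<le> B"
    by (metis bounded_iff imageI)
  then have "AE x in M. norm (f x) \<le> B"
    by (intro AE_I2) (simp only: space_M)
  then show ?thesis
    using borel_measurable_continuous[OF assms] by (rule integrable_const_bound)
qed

lemma sets_borel_Int: "A \<in> sets borel \<Longrightarrow> A \<inter> usphere \<in> sets M"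
  by (simp add: sets_M sets_restrict_space_iff)

lemma cap_eq: "{v\<in>usphere. \<delta> \<le> u \<bullet> v} = {v. \<delta> \<le> u \<bullet> v} \<inter> usphere"
  by auto

lemma sets_cap: "{v\<in>usphere. \<delta> \<le> u \<bullet> v} \<in> sets M"
  unfolding cap_eq by (rule sets_borel_Int) (simp add: closed_halfspace_ge borel_closed)

text \<open>The function \<open>T\<close> is Lipschitz and vanishes nowhere on the sphere, so by
  compactness it has a positive minimum there. This minimum is then converted into a lower bound for
  the mass of caps, uniform in the direction.\<close>

lemma uniform_cap_bound:
  assumes "\<not> (\<exists>v\<in>usphere. concentrated_in M (closed_hemisphere v))"
  obtains \<delta> c where "0 < \<delta>" "0 < c" "\<And>u. u \<in> usphere \<Longrightarrow> c \<le> measure M {v\<in>usphere. \<delta> \<le> u \<bullet> v}"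
proof -
  define T where "T u = (\<integral>v. max 0 (u \<bullet> v) \<partial>M)" for u
  define m where "m = measure M (space M)"
  have int: "integrable M (\<lambda>v. max 0 (u \<bullet> v))" for u
    by (rule integrable_continuous) (intro continuous_intros)
  have "\<bar>T u - T u'\<bar> \<le> m * norm (u - u')" for u u'
  proof -
    have "\<bar>T u - T u'\<bar> = \<bar>\<integral>v. max 0 (u \<bullet> v) - max 0 (u' \<bullet> v) \<partial>M\<bar>"
      unfolding T_def by (simp add: Bochner_Integration.integral_diff int)
    also have "\<dots> \<le> (\<integral>v. \<bar>max 0 (u \<bullet> v) - max 0 (u' \<bullet> v)\<bar> \<partial>M)"
      by (rule integral_abs_bound)
    also have "\<dots> \<le> (\<integral>v. norm (u - u') \<partial>M)"
    proof (rule integral_mono)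
      fix v assume "v \<in> space M"
      then have "\<bar>(u - u') \<bullet> v\<bar> \<le> norm (u - u')"
        using Cauchy_Schwarz_ineq2[of "u - u'" v] by (simp add: space_M)
      then show "\<bar>max 0 (u \<bullet> v) - max 0 (u' \<bullet> v)\<bar> \<le> norm (u - u')"
        by (auto simp: inner_diff_left max_def)
    qed (use int in auto)
    also have "\<dots> = m * norm (u - u')" by (simp add: m_def)
    finally show ?thesis .
  qed
  then have "m-lipschitz_on usphere T"
    by (intro lipschitz_onI) (auto simp: dist_norm m_def)
  then have "continuous_on usphere T" by (rule lipschitz_on_continuous_on)
  then obtain u0 where u0: "u0 \<in> usphere" "\<And>u. u \<in> usphere \<Longrightarrow> T u0 \<le> T u"
    using continuous_attains_inf[OF compact_sphere usphere_nonempty] by blast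
  \<comment> \<open>A zero integral would make the open hemisphere around \<open>u0\<close> a null
    set, so that \<open>M\<close> would be concentrated in the opposite closed one.\<close>
  have "T u0 \<noteq> 0"
  proof
    assume "T u0 = 0"
    then have ae: "AE v in M. max 0 (u0 \<bullet> v) = 0"
      unfolding T_def by (subst (asm) integral_nonneg_eq_0_iff_AE[OF int]) auto
    have eq: "{v \<in> space M. \<not> max 0 (u0 \<bullet> v) = 0} = usphere - closed_hemisphere (- u0)"
      by (auto simp: space_M closed_hemisphere_def inner_commute max_def)
    have "usphere - closed_hemisphere (- u0) = {v. 0 < u0 \<bullet> v} \<inter> usphere"
      by (auto simp: closed_hemisphere_def inner_commute)
    then have "usphere - closed_hemisphere (- u0) \<in> sets M"
      by (simp add: sets_borel_Int open_halfspace_gt borel_open)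
    then have "concentrated_in M (closed_hemisphere (- u0))"
      using ae unfolding concentrated_in_def eq[symmetric]
      by (subst (asm) AE_iff_measurable[OF _ refl]) simp_all
    then show False using assms u0 by auto
  qed
  moreover have "0 \<le> T u0" unfolding T_def by (rule Bochner_Integration.integral_nonneg) auto
  ultimately have pos: "0 < T u0" by simp
  \<comment> \<open>The integrand of \<open>T\<close> is at most 1 on the cap and below
    \<open>\<delta>\<close> off it.\<close>
  have bound: "T u \<le> measure M {v\<in>usphere. \<delta> \<le> u \<bullet> v} + \<delta> * m"
    if "u \<in> usphere" "0 < \<delta>" for u \<delta>
  proof -
    have "T u \<le> (\<integral>v. indicator {v\<in>usphere. \<delta> \<le> u \<bullet> v} v + \<delta> \<partial>M)"
      unfolding T_def
    proof (rule integral_mono)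
      fix v assume "v \<in> space M"
      moreover then have "u \<bullet> v \<le> 1"
        using norm_cauchy_schwarz[of u v] that by (simp add: space_M)
      ultimately show "max 0 (u \<bullet> v) \<le> indicator {v\<in>usphere. \<delta> \<le> u \<bullet> v} v + \<delta>"
        using that by (auto simp: indicator_def space_M)
    qed (use int sets_cap in \<open>auto simp: integrable_indicator_iff less_top[symmetric]\<close>)
    also have "\<dots> = measure M {v\<in>usphere. \<delta> \<le> u \<bullet> v} + \<delta> * m"
      using sets_cap sets.sets_into_space[OF sets_cap]
      by (subst Bochner_Integration.integral_add)
         (auto simp: m_def integrable_indicator_iff less_top[symmetric] Int_absorb2)
    finally show ?thesis .
  qed
  \<comment> \<open>Small enough that the part of \<open>T u\<close> off the cap is at most half of
    the minimum \<open>T u0\<close>; \<open>m + 1\<close> keeps the denominator positive.\<close>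
  define \<delta> where "\<delta> = T u0 / (2 * (m + 1))"
  have m0: "0 \<le> m" by (simp add: m_def)
  have \<delta>: "0 < \<delta>" "\<delta> * m \<le> T u0 / 2"
    using pos m0 by (auto simp: \<delta>_def field_simps)
  show thesis
  proof (rule that[of \<delta> "T u0 / 2"])
    fix u :: 'a assume "u \<in> usphere"
    then show "T u0 / 2 \<le> measure M {v\<in>usphere. \<delta> \<le> u \<bullet> v}"
      using bound[of u \<delta>] u0(2)[of u] \<delta> by linarith
  qed (use pos \<delta> in auto)
qed

end

section \<open>Finiteness and positivity of the surface measure\<close>

lemma usphere_measure_sphere_measure: "usphere_measure (sphere_measure :: 'a::euclidean_space measure)"
proof (intro usphere_measure.intro finite_measureI usphere_measure_axioms.intro)
  have sp: "space (sphere_measure :: 'a measure) = usphere"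
    using sets_eq_imp_space_eq[OF sets_sphere_measure] by (simp add: space_restrict_space)
  have "emeasure lborel {x \<in> cball (0::'a) 1 - {0}. x /\<^sub>R norm x \<in> usphere} \<le> emeasure lborel (cball (0::'a) 1)"
    by (rule emeasure_mono) auto
  also have "\<dots> < \<infinity>" by (rule emeasure_bounded_finite) simp
  finally show "emeasure (sphere_measure :: 'a measure) (space sphere_measure) \<noteq> \<infinity>"
    unfolding sp by (subst emeasure_sphere_measure) (auto simp: ennreal_mult_eq_top_iff)
qed (rule sets_sphere_measure)

interpretation sphere_measure: usphere_measure sphere_measure
  by (rule usphere_measure_sphere_measure)

lemma null_sphere_measureI:
  assumes "A \<in> sets borel" "A \<subseteq> usphere"
    and "{x \<in> cball 0 1 - {0}. x /\<^sub>R norm x \<in> A} \<subseteq> N" "N \<in> null_sets lborel"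
  shows "A \<in> null_sets sphere_measure"
proof -
  have "emeasure lborel {x \<in> cball 0 1 - {0}. x /\<^sub>R norm x \<in> A} \<le> emeasure lborel N"
    using assms(3,4) by (intro emeasure_mono) auto
  then have "emeasure sphere_measure A = 0"
    using assms(4) by (simp add: emeasure_sphere_measure[OF assms(1,2)] null_setsD1)
  then show ?thesis
    using sphere_measure.sets_borel_Int[OF assms(1)] assms(2)
    by (simp add: null_sets_def Int_absorb2)
qed

text \<open>The cone over the relatively open set contains the nonempty open set \<open>?W\<close>,
  and nonempty open sets have positive Lebesgue measure.\<close>

lemma emeasure_sphere_measure_open_pos:
  assumes "open U" "u \<in> U" "u \<in> usphere"
  shows "0 < emeasure sphere_measure (U \<inter> usphere)"
proof -
  let ?W = "(ball 0 1 - {0}) \<inter> (\<lambda>x. x /\<^sub>R norm x) -` U"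
  have "open ?W"
    by (intro continuous_open_preimage assms(1) continuous_intros) auto
  \<comment> \<open>The unit vector \<open>u\<close> itself lies outside the open ball used in
    \<open>?W\<close>, hence the factor 1/2.\<close>
  moreover have "(1/2) *\<^sub>R u \<in> ?W" using assms by auto
  then have "?W \<noteq> {}" by blast
  ultimately have "0 < emeasure lborel ?W"
    using open_not_negligible[of ?W]
    by (auto simp: negligible_iff_null_sets null_sets_completion_iff borel_open null_sets_def
        zero_less_iff_neq_zero)
  also have "\<dots> \<le> emeasure lborel {x \<in> cball 0 1 - {0}. x /\<^sub>R norm x \<in> U \<inter> usphere}"
  proof (rule emeasure_mono)
    have "{x \<in> cball 0 1 - {0}. x /\<^sub>R norm x \<in> U \<inter> usphere}
      = {x \<in> cball 0 1 - {0}. x /\<^sub>R norm x \<in> U}" by auto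
    moreover have "(\<lambda>x::'a. x /\<^sub>R norm x) \<in> borel_measurable borel" by measurable
    ultimately show "{x \<in> cball 0 1 - {0}. x /\<^sub>R norm x \<in> U \<inter> usphere} \<in> sets lborel"
      using measurable_sets[of "\<lambda>x::'a. x /\<^sub>R norm x" borel borel U] assms(1)
      by (simp add: Collect_conj_eq vimage_def sets.Diff borel_open borel_closed)
  qed auto
  finally have "0 < emeasure lborel {x \<in> cball 0 1 - {0}. x /\<^sub>R norm x \<in> U \<inter> usphere}" .
  then show ?thesis
    using assms(1)
    by (subst emeasure_sphere_measure) (auto simp: ennreal_zero_less_mult_iff borel_open borel_closed)
qed

lemma sphere_measure_not_concentrated:
  "\<not> (\<exists>v\<in>usphere. concentrated_in sphere_measure (closed_hemisphere (v::'a::euclidean_space)))"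
proof
  assume "\<exists>v\<in>usphere. concentrated_in sphere_measure (closed_hemisphere (v::'a))"
  then obtain v :: 'a where v: "v \<in> usphere" "concentrated_in sphere_measure (closed_hemisphere v)"
    by blast
  have "usphere - closed_hemisphere v = {x. x \<bullet> v < 0} \<inter> usphere"
    by (auto simp: closed_hemisphere_def)
  moreover have "open {x. x \<bullet> v < 0}"
    using open_halfspace_lt[of v 0] by (simp add: inner_commute)
  then have "0 < emeasure sphere_measure ({x. x \<bullet> v < 0} \<inter> usphere)"
    by (rule emeasure_sphere_measure_open_pos[where u="- v"]) (use v in \<open>auto simp: dot_square_norm\<close>)
  ultimately show False using v by (simp add: concentrated_in_def)
qed

text \<open>Indicators of closed sets are limits of bounded continuous functions, and the closed
  sets are an intersection-stable generator of the Borel sets.\<close>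

lemma usphere_measure_eqI:
  fixes M N :: "'a::euclidean_space measure"
  assumes "usphere_measure M" "usphere_measure N"
    and eq: "\<And>\<psi> :: 'a \<Rightarrow> real. continuous_on usphere \<psi> \<Longrightarrow> (\<integral>v. \<psi> v \<partial>M) = (\<integral>v. \<psi> v \<partial>N)"
  shows "M = N"
proof -
  interpret M: usphere_measure M by fact
  interpret N: usphere_measure N by fact
  \<comment> \<open>The empty set is excluded because \<open>infdist\<close> to it is 0 by
    convention, which would make every approximating function constantly 1.\<close>
  have tend: "(\<lambda>n. \<integral>v. max 0 (1 - real n * infdist v C) \<partial>L) \<longlonglongrightarrow> measure L (C \<inter> usphere)"
    if C: "closed C" "C \<noteq> {}" and L: "usphere_measure L" for C and L :: "'a measure"
  proof -
    interpret L: usphere_measure L by fact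
    have "(\<lambda>n. \<integral>v. max 0 (1 - real n * infdist v C) \<partial>L) \<longlonglongrightarrow> (\<integral>v. indicator (C \<inter> usphere) v \<partial>L)"
    proof (rule integral_dominated_convergence)
      show "AE v in L. (\<lambda>n. max 0 (1 - real n * infdist v C)) \<longlonglongrightarrow> indicator (C \<inter> usphere) v"
      proof (rule AE_I2)
        fix v assume "v \<in> space L"
        then have v: "v \<in> usphere" by (simp only: L.space_M)
        show "(\<lambda>n. max 0 (1 - real n * infdist v C)) \<longlonglongrightarrow> indicator (C \<inter> usphere) v"
        proof (cases "v \<in> C")
          case False
          then have pos: "0 < infdist v C"
            using C infdist_nonneg[of v C] in_closed_iff_infdist_zero[OF C] by force
          then obtain k where k: "1 < real k * infdist v C" using reals_Archimedean3 by blast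
          have "max 0 (1 - real n * infdist v C) = 0" if "k \<le> n" for n
          proof -
            have "real k * infdist v C \<le> real n * infdist v C"
              using that pos by (intro mult_right_mono) auto
            then show ?thesis using k by simp
          qed
          then have "\<forall>\<^sub>F n in sequentially. max 0 (1 - real n * infdist v C) = 0"
            unfolding eventually_sequentially by blast
          then show ?thesis using False by (simp add: tendsto_eventually)
        qed (use v in simp)
      qed
      show "(\<lambda>v. max 0 (1 - real n * infdist v C)) \<in> borel_measurable L" for n
        by (intro L.borel_measurable_continuous continuous_intros)
      show "AE v in L. norm (max 0 (1 - real n * infdist v C)) \<le> 1" for n
        by (intro AE_I2) (simp add: infdist_nonneg)
      show "indicat_real (C \<inter> usphere) \<in> borel_measurable L"
        using L.sets_borel_Int[OF borel_closed[OF C(1)]] by simp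
    qed simp
    also have "(\<integral>v. indicator (C \<inter> usphere) v \<partial>L) = measure L (C \<inter> usphere)"
      by (simp add: L.space_M Int_assoc)
    finally show ?thesis .
  qed
  have closed_eq: "emeasure M (C \<inter> usphere) = emeasure N (C \<inter> usphere)" if C: "closed C" for C
  proof (cases "C = {}")
    case False
    have "(\<integral>v. max 0 (1 - real n * infdist v C) \<partial>M) = (\<integral>v. max 0 (1 - real n * infdist v C) \<partial>N)" for n
      by (intro eq continuous_intros)
    then have "measure M (C \<inter> usphere) = measure N (C \<inter> usphere)"
      using tend[OF C False \<open>usphere_measure M\<close>] tend[OF C False \<open>usphere_measure N\<close>]
      by (simp add: LIMSEQ_unique)
    then show ?thesis by (simp add: M.emeasure_eq_measure N.emeasure_eq_measure)
  qed simp
  \<comment> \<open>Both measures are moved to the whole space, where the closed sets generate the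
    Borel sets.\<close>
  have ext: "emeasure (distr L borel (\<lambda>x. x)) A = emeasure L (A \<inter> usphere)"
    if "A \<in> sets borel" "usphere_measure L" for A and L :: "'a measure"
  proof -
    interpret L: usphere_measure L by fact
    show ?thesis
      using L.borel_measurable_continuous[OF continuous_on_id] that
      by (subst emeasure_distr) (auto simp: L.space_M)
  qed
  note ext = ext[OF _ \<open>usphere_measure M\<close>] ext[OF _ \<open>usphere_measure N\<close>]
  have glob: "distr M borel (\<lambda>x. x) = distr N borel (\<lambda>x. x)"
  proof (rule measure_eqI_generator_eq[where E="Collect closed" and \<Omega>=UNIV and A="\<lambda>_. UNIV"])
    show "Int_stable (Collect closed :: 'a set set)" by (auto simp: Int_stable_def)
    show "emeasure (distr M borel (\<lambda>x. x)) C = emeasure (distr N borel (\<lambda>x. x)) C" if "C \<in> Collect closed" for C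
      using that by (simp add: ext borel_closed closed_eq)
    show "sets (distr M borel (\<lambda>x. x)) = sigma_sets UNIV (Collect closed)"
      "sets (distr N borel (\<lambda>x. x)) = sigma_sets UNIV (Collect closed)"
      by (simp_all add: borel_eq_closed)
    show "emeasure (distr M borel (\<lambda>x. x)) UNIV \<noteq> \<infinity>"
      using M.emeasure_finite by (simp add: ext)
  qed auto
  show "M = N"
  proof (rule measure_eqI)
    show "sets M = sets N" by (simp add: M.sets_M N.sets_M)
    fix A assume "A \<in> sets M"
    then have A: "A \<in> sets borel" "A \<inter> usphere = A"
      by (auto simp: M.sets_M sets_restrict_space_iff)
    show "emeasure M A = emeasure N A"
      using ext[OF A(1)] glob A(2) by simp
  qed
qed

section \<open>The energy and its minimizers\<close>

text \<open>The maximizer for \<open>f\<close> is a competitor in the gauge of \<open>g\<close>, and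
  the error is governed by the change of \<open>1 / f\<close> at that point. This transfers uniform
  convergence of functions to their gauges.\<close>

lemma wulff_gauge_le_add:
  assumes f: "pos_cont f" and g: "pos_cont g" and a: "0 < a"
    and "\<And>u. u \<in> usphere \<Longrightarrow> a \<le> f u" "\<And>u. u \<in> usphere \<Longrightarrow> a \<le> g u"
    and e: "\<And>u. u \<in> usphere \<Longrightarrow> \<bar>f u - g u\<bar> \<le> e"
  shows "wulff_gauge f x \<le> wulff_gauge g x + norm x * (e / a\<^sup>2)"
proof -
  obtain v where v: "v \<in> usphere" "wulff_gauge f x = (x \<bullet> v) / f v"
    using wulff_gauge_attained[OF f] by metis
  have pos: "0 < f v" "0 < g v" using pos_contD f g v by auto
  have "\<bar>x \<bullet> v\<bar> \<le> norm x"
    using Cauchy_Schwarz_ineq2[of x v] v by simp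
  moreover have "\<bar>1 / f v - 1 / g v\<bar> \<le> e / a\<^sup>2"
  proof -
    have "1 / f v - 1 / g v = (g v - f v) / (f v * g v)" using pos by (simp add: field_simps)
    also have "\<bar>\<dots>\<bar> = \<bar>f v - g v\<bar> / (f v * g v)"
      using pos by (simp add: abs_mult abs_minus_commute)
    also have "\<dots> \<le> e / a\<^sup>2"
      using assms(4)[OF v(1)] assms(5)[OF v(1)] a e[OF v(1)]
      by (intro frac_le) (auto simp: power2_eq_square intro: mult_mono)
    finally show ?thesis .
  qed
  ultimately have "\<bar>x \<bullet> v\<bar> * \<bar>1 / f v - 1 / g v\<bar> \<le> norm x * (e / a\<^sup>2)"
    by (intro mult_mono) auto
  then have "(x \<bullet> v) * (1 / f v - 1 / g v) \<le> norm x * (e / a\<^sup>2)"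
    by (metis abs_mult abs_ge_self order_trans)
  then show ?thesis
    using wulff_gauge_upper[OF g v(1), of x] v(2) by (simp add: right_diff_distrib)
qed

text \<open>Later \<open>\<sigma>\<close> is the surface measure, \<open>w\<close> is a power of the
  radial function of \<open>Q\<close> divided by the dimension, and \<open>p\<close> is
  \<open>- q\<close>. The spread of \<open>\<sigma>\<close> keeps Wulff shapes of bounded energy
  from becoming thin, the spread of \<open>\<mu>\<close> keeps them bounded.\<close>

locale wulff_energy = \<sigma>: usphere_measure \<sigma> + \<mu>: usphere_measure \<mu>
  for \<sigma> \<mu> :: "'a::euclidean_space measure" +
  fixes w :: "'a \<Rightarrow> real" and p :: real
  assumes p: "0 < p" and w: "pos_cont w"
    and \<sigma>_spread: "\<not> (\<exists>v\<in>usphere. concentrated_in \<sigma> (closed_hemisphere v))"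
    and \<mu>_spread: "\<not> (\<exists>v\<in>usphere. concentrated_in \<mu> (closed_hemisphere v))"
begin

definition energy :: "('a \<Rightarrow> real) \<Rightarrow> real" where
  "energy g = (\<integral>u. wulff_gauge g u powr p * w u \<partial>\<sigma>) / p + (\<integral>v. ln (g v) \<partial>\<mu>)"

lemma continuous_on_powr_weight:
  assumes "pos_cont h"
  shows "continuous_on usphere (\<lambda>u. h u powr p * w u)"
  using assms w by (auto simp: pos_cont_def intro!: continuous_intros dest: less_imp_neq)

lemma integrable_powr_weight: "pos_cont h \<Longrightarrow> integrable \<sigma> (\<lambda>u. h u powr p * w u)"
  by (intro \<sigma>.integrable_continuous continuous_on_powr_weight)

lemma continuous_on_ln: "pos_cont g \<Longrightarrow> continuous_on usphere (\<lambda>v. ln (g v))"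
  by (auto simp: pos_cont_def intro!: continuous_intros dest: less_imp_neq)

lemma integrable_ln: "pos_cont g \<Longrightarrow> integrable \<mu> (\<lambda>v. ln (g v))"
  by (intro \<mu>.integrable_continuous continuous_on_ln)

text \<open>Neither term increases, by \<open>wulff_gauge_twice_le\<close>: it is used for
  \<open>g\<close> in the logarithmic term and for \<open>wulff_gauge g\<close> in the power
  term.\<close>

lemma energy_wulff_gauge_twice:
  assumes "pos_cont g"
  shows "energy (wulff_gauge (wulff_gauge g)) \<le> energy g"
proof -
  note pc = pos_cont_wulff_gauge[OF assms] pos_cont_wulff_gauge[OF pos_cont_wulff_gauge[OF assms]]
    pos_cont_wulff_gauge[OF pos_cont_wulff_gauge[OF pos_cont_wulff_gauge[OF assms]]]
  have "(\<integral>u. wulff_gauge (wulff_gauge (wulff_gauge g)) u powr p * w u \<partial>\<sigma>)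
      \<le> (\<integral>u. wulff_gauge g u powr p * w u \<partial>\<sigma>)"
  proof (rule integral_mono)
    fix u assume "u \<in> space \<sigma>"
    then have u: "u \<in> usphere" by (simp only: \<sigma>.space_M)
    show "wulff_gauge (wulff_gauge (wulff_gauge g)) u powr p * w u \<le> wulff_gauge g u powr p * w u"
      using wulff_gauge_twice_le[OF pc(1) u] pos_contD[OF pc(3) u] pos_contD[OF w u] p
      by (intro mult_right_mono powr_mono2) auto
  qed (use pc in \<open>auto intro: integrable_powr_weight\<close>)
  moreover have "(\<integral>v. ln (wulff_gauge (wulff_gauge g) v) \<partial>\<mu>) \<le> (\<integral>v. ln (g v) \<partial>\<mu>)"
  proof (rule integral_mono)
    fix v assume "v \<in> space \<mu>"
    then have v: "v \<in> usphere" by (simp only: \<mu>.space_M)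
    show "ln (wulff_gauge (wulff_gauge g) v) \<le> ln (g v)"
      using wulff_gauge_twice_le[OF assms v] pos_contD[OF pc(2) v] by (intro ln_mono) auto
  qed (use pc assms in \<open>auto intro: integrable_ln\<close>)
  ultimately show ?thesis
    unfolding energy_def using p by (intro add_mono divide_right_mono) auto
qed

section \<open>Coercivity of the energy\<close>

text \<open>Let \<open>a\<close> be the minimum of \<open>g\<close>, attained at \<open>v0\<close>.
  The gauge is at least \<open>\<delta> / a\<close> on a cap around \<open>v0\<close> whose mass is
  at least \<open>c\<close>, so the power term is at least \<open>A * (1 / a) powr p\<close>, while
  the logarithmic term is at least \<open>m * ln a\<close>. A small \<open>a\<close> therefore
  forces a large energy.\<close>

lemma energy_bounded_imp_lower_bound:
  obtains a where "0 < a"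
    "\<And>g v. pos_cont g \<Longrightarrow> energy g \<le> C \<Longrightarrow> v \<in> usphere \<Longrightarrow> a \<le> g v"
proof -
  obtain \<delta> c where \<delta>: "0 < \<delta>" "0 < c"
    "\<And>u. u \<in> usphere \<Longrightarrow> c \<le> measure \<sigma> {v\<in>usphere. \<delta> \<le> u \<bullet> v}"
    using \<sigma>.uniform_cap_bound[OF \<sigma>_spread] by metis
  obtain w0 where w0: "0 < w0" "\<And>u. u \<in> usphere \<Longrightarrow> w0 \<le> w u"
    using pos_cont_lower[OF w] by metis
  define m where "m = measure \<mu> (space \<mu>)"
  define A where "A = \<delta> powr p * w0 * c / p"
  have A: "0 < A" using \<delta> w0 p by (simp add: A_def)
  \<comment> \<open>Here \<open>y\<close> stands for \<open>1 / a\<close>; the power dominates the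
    logarithm at infinity.\<close>
  have "filterlim (\<lambda>y. A * y powr p - m * ln y) at_top at_top"
    using A p by real_asymp
  then have "eventually (\<lambda>y. C < A * y powr p - m * ln y) at_top"
    by (simp add: filterlim_at_top_dense)
  then obtain y0' where y0': "\<And>y. y0' \<le> y \<Longrightarrow> C < A * y powr p - m * ln y"
    unfolding eventually_at_top_linorder by blast
  define y0 where "y0 = max 1 y0'"
  have y0: "0 < y0" "\<And>y. y0 \<le> y \<Longrightarrow> C < A * y powr p - m * ln y"
    using y0' by (auto simp: y0_def)
  show thesis
  proof (rule that[of "1 / y0"])
    fix g and v :: 'a assume g: "pos_cont g" "energy g \<le> C" and v: "v \<in> usphere"
    obtain v0 where v0: "v0 \<in> usphere" "\<And>u. u \<in> usphere \<Longrightarrow> g v0 \<le> g u"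
      using pos_cont_attains_min[OF g(1)] by metis
    define a where "a = g v0"
    have a: "0 < a" using pos_contD[OF g(1) v0(1)] by (simp add: a_def)
    let ?D = "{u\<in>usphere. \<delta> \<le> v0 \<bullet> u}"
    note pc = pos_cont_wulff_gauge[OF g(1)]
    have "(\<delta> / a) powr p * w0 * c \<le> (\<delta> / a) powr p * w0 * measure \<sigma> ?D"
      using \<delta>(3)[OF v0(1)] w0 by (intro mult_left_mono) auto
    also have "\<dots> = (\<integral>u. ((\<delta> / a) powr p * w0) * indicator ?D u \<partial>\<sigma>)"
      using sets.sets_into_space[OF \<sigma>.sets_cap, of \<delta> v0] by (simp add: Int_absorb2)
    also have "\<dots> \<le> (\<integral>u. wulff_gauge g u powr p * w u \<partial>\<sigma>)"
    proof (rule integral_mono)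
      fix u assume "u \<in> space \<sigma>"
      then have u: "u \<in> usphere" by (simp only: \<sigma>.space_M)
      have "(\<delta> / a) powr p * w0 \<le> wulff_gauge g u powr p * w u" if "\<delta> \<le> v0 \<bullet> u"
      proof (intro mult_mono powr_mono2)
        have "\<delta> / a \<le> (u \<bullet> v0) / a"
          using that a by (simp add: divide_right_mono inner_commute)
        also have "\<dots> \<le> wulff_gauge g u"
          using wulff_gauge_upper[OF g(1) v0(1)] by (simp add: a_def)
        finally show "\<delta> / a \<le> wulff_gauge g u" .
      qed (use w0 u \<delta> a p in auto)
      then show "((\<delta> / a) powr p * w0) * indicator ?D u \<le> wulff_gauge g u powr p * w u"
        using pos_contD[OF pc u] pos_contD[OF w u] by (auto simp: indicator_def)
    qed (use integrable_powr_weight[OF pc] \<sigma>.sets_cap in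
        \<open>auto simp: integrable_indicator_iff less_top[symmetric]\<close>)
    finally have 1: "(\<delta> / a) powr p * w0 * c / p \<le> (\<integral>u. wulff_gauge g u powr p * w u \<partial>\<sigma>) / p"
      using p by (intro divide_right_mono) auto
    have "m * ln a = (\<integral>v. ln a \<partial>\<mu>)" by (simp add: m_def)
    also have "\<dots> \<le> (\<integral>v. ln (g v) \<partial>\<mu>)"
    proof (rule integral_mono)
      fix v assume "v \<in> space \<mu>"
      then have "v \<in> usphere" by (simp only: \<mu>.space_M)
      then show "ln a \<le> ln (g v)" using v0(2) a by (intro ln_mono) (auto simp: a_def)
    qed (use integrable_ln[OF g(1)] in auto)
    finally have "A * (1 / a) powr p - m * ln (1 / a) \<le> C"
      using 1 g(2) a \<delta> by (simp add: energy_def A_def powr_divide ln_div field_simps)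
    then have "1 / a < y0" using y0(2)[of "1 / a"] by (meson not_le)
    then have "1 / y0 \<le> a" using a y0(1) by (simp add: field_simps)
    then show "1 / y0 \<le> g v" using v0(2)[OF v] by (simp add: a_def)
  qed (use y0 in simp)
qed

text \<open>If \<open>h\<close> has a small minimum \<open>r\<close>, attained at \<open>u0\<close>,
  then \<open>wulff_gauge h\<close> is at least \<open>\<delta> / r\<close> on a cap of mass at
  least \<open>c\<close>, and at least \<open>a\<close> everywhere, so the integral of its logarithm
  is large. When \<open>h\<close> is itself the gauge of a Wulff shape, the bound confines that
  shape to a fixed ball.\<close>

lemma energy_bounded_imp_polar_lower_bound:
  obtains r where "0 < r"
    "\<And>h u. pos_cont h \<Longrightarrow> energy (wulff_gauge h) \<le> C \<Longrightarrow> u \<in> usphere \<Longrightarrow> r \<le> h u"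
proof -
  obtain \<delta> c where \<delta>: "0 < \<delta>" "0 < c"
    "\<And>u. u \<in> usphere \<Longrightarrow> c \<le> measure \<mu> {v\<in>usphere. \<delta> \<le> u \<bullet> v}"
    using \<mu>.uniform_cap_bound[OF \<mu>_spread] by metis
  obtain a where a: "0 < a"
    "\<And>g v. pos_cont g \<Longrightarrow> energy g \<le> C \<Longrightarrow> v \<in> usphere \<Longrightarrow> a \<le> g v"
    using energy_bounded_imp_lower_bound[where C=C] by blast
  define m where "m = measure \<mu> (space \<mu>)"
  \<comment> \<open>The value of \<open>ln r\<close> for which the lower bound of the logarithmic
    integral derived below equals \<open>C\<close>.\<close>
  define E where "E = ln \<delta> - ln a - (C - m * ln a) / c"
  show thesis
  proof (rule that[of "min (\<delta> / a) (exp E)"])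
    fix h and u :: 'a assume h: "pos_cont h" "energy (wulff_gauge h) \<le> C" and u: "u \<in> usphere"
    note pc = pos_cont_wulff_gauge[OF h(1)]
    obtain u0 where u0: "u0 \<in> usphere" "\<And>u. u \<in> usphere \<Longrightarrow> h u0 \<le> h u"
      using pos_cont_attains_min[OF h(1)] by metis
    define r where "r = h u0"
    have r: "0 < r" using pos_contD[OF h(1) u0(1)] by (simp add: r_def)
    \<comment> \<open>In this case \<open>\<delta> / r\<close> exceeds \<open>a\<close>, so the
      coefficient of the cap mass is nonnegative and that mass may be replaced by
      \<open>c\<close>.\<close>
    have "exp E \<le> r" if "r < \<delta> / a"
    proof -
      let ?D = "{v\<in>usphere. \<delta> \<le> u0 \<bullet> v}"
      have ar: "a \<le> \<delta> / r" using that a r by (simp add: field_simps)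
      then have ge: "0 \<le> ln (\<delta> / r) - ln a" using a by (simp add: ln_mono)
      have "c * (ln (\<delta> / r) - ln a) + m * ln a \<le> measure \<mu> ?D * (ln (\<delta> / r) - ln a) + m * ln a"
        using \<delta>(3)[OF u0(1)] ge by (intro add_right_mono mult_right_mono) auto
      also have "\<dots> = (\<integral>v. indicator ?D v * (ln (\<delta> / r) - ln a) + ln a \<partial>\<mu>)"
        using \<mu>.sets_cap sets.sets_into_space[OF \<mu>.sets_cap, of \<delta> u0]
        by (subst Bochner_Integration.integral_add)
           (auto simp: m_def integrable_indicator_iff less_top[symmetric] Int_absorb2)
      also have "\<dots> \<le> (\<integral>v. ln (wulff_gauge h v) \<partial>\<mu>)"
      proof (rule integral_mono)
        fix v assume "v \<in> space \<mu>"
        then have v: "v \<in> usphere" by (simp only: \<mu>.space_M)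
        have "ln a \<le> ln (wulff_gauge h v)" using a(2)[OF pc h(2) v] a(1) by simp
        moreover have "ln (\<delta> / r) \<le> ln (wulff_gauge h v)" if "\<delta> \<le> u0 \<bullet> v"
        proof (rule ln_mono)
          have "\<delta> / r \<le> (v \<bullet> u0) / r" using that r by (simp add: divide_right_mono inner_commute)
          also have "\<dots> \<le> wulff_gauge h v"
            using wulff_gauge_upper[OF h(1) u0(1)] by (simp add: r_def)
          finally show "\<delta> / r \<le> wulff_gauge h v" .
        qed (use \<delta> r in simp)
        ultimately show "indicator ?D v * (ln (\<delta> / r) - ln a) + ln a \<le> ln (wulff_gauge h v)"
          by (auto simp: indicator_def)
      qed (use integrable_ln[OF pc] \<mu>.sets_cap in
        \<open>auto simp: integrable_indicator_iff less_top[symmetric]\<close>)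
      also have "\<dots> \<le> C"
      proof -
        have "0 \<le> (\<integral>u. wulff_gauge (wulff_gauge h) u powr p * w u \<partial>\<sigma>)"
          using pos_contD[OF w] by (intro Bochner_Integration.integral_nonneg) (auto simp: \<sigma>.space_M less_imp_le)
        then have "0 \<le> (\<integral>u. wulff_gauge (wulff_gauge h) u powr p * w u \<partial>\<sigma>) / p"
          using p by simp
        then show ?thesis using h(2) unfolding energy_def by linarith
      qed
      finally have "ln (\<delta> / r) - ln a \<le> (C - m * ln a) / c"
        using \<delta>(2) by (simp add: field_simps)
      then have "E \<le> ln r" using \<delta> r by (simp add: E_def ln_div)
      then show ?thesis using r by (metis exp_le_cancel_iff exp_ln)
    qed
    then have "min (\<delta> / a) (exp E) \<le> r" by linarith
    then show "min (\<delta> / a) (exp E) \<le> h u" using u0(2)[OF u] by (simp add: r_def)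
  qed (use \<delta> a in simp)
qed

section \<open>Existence of a minimizer\<close>

text \<open>Uniform convergence gives pointwise convergence of the gauges, and the bounds
  \<open>a\<close> and \<open>b\<close> supply constant majorants for dominated convergence.\<close>

lemma energy_tendsto:
  assumes f: "\<And>n. pos_cont (f n)" and g: "pos_cont g" and a: "0 < a"
    and lower: "\<And>n u. u \<in> usphere \<Longrightarrow> a \<le> f n u" "\<And>u. u \<in> usphere \<Longrightarrow> a \<le> g u"
    and upper: "\<And>n u. u \<in> usphere \<Longrightarrow> f n u \<le> b"
    and unif: "\<And>e. 0 < e \<Longrightarrow> \<exists>N. \<forall>n\<ge>N. \<forall>u\<in>usphere. \<bar>f n u - g u\<bar> < e"
  shows "(\<lambda>n. energy (f n)) \<longlonglongrightarrow> energy g"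
proof -
  have lim: "(\<lambda>n. f n u) \<longlonglongrightarrow> g u" if "u \<in> usphere" for u
    unfolding lim_sequentially dist_real_def using unif that by meson
  have limw: "(\<lambda>n. wulff_gauge (f n) u) \<longlonglongrightarrow> wulff_gauge g u" if u: "u \<in> usphere" for u
  proof (rule LIMSEQ_I)
    fix e :: real assume e: "0 < e"
    \<comment> \<open>With this tolerance \<open>wulff_gauge_le_add\<close> yields an error of
      \<open>e / 2\<close> at unit vectors.\<close>
    then obtain N where N: "\<And>n v. N \<le> n \<Longrightarrow> v \<in> usphere \<Longrightarrow> \<bar>f n v - g v\<bar> < e / 2 * a\<^sup>2"
      using unif[of "e / 2 * a\<^sup>2"] a by (meson half_gt_zero mult_pos_pos zero_less_power)
    have "norm (wulff_gauge (f n) u - wulff_gauge g u) < e" if "N \<le> n" for n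
    proof -
      have b: "\<bar>f n v - g v\<bar> \<le> e / 2 * a\<^sup>2" "\<bar>g v - f n v\<bar> \<le> e / 2 * a\<^sup>2" if "v \<in> usphere" for v
        using N[OF \<open>N \<le> n\<close> that] by (auto simp: abs_minus_commute)
      show ?thesis
        using wulff_gauge_le_add[OF f g a lower b(1), of u] wulff_gauge_le_add[OF g f a lower(2,1) b(2), of u]
          e a u by auto
    qed
    then show "\<exists>N. \<forall>n\<ge>N. norm (wulff_gauge (f n) u - wulff_gauge g u) < e" by blast
  qed
  obtain B where B: "0 < B" "\<And>u. u \<in> usphere \<Longrightarrow> w u \<le> B"
    using pos_cont_upper[OF w] by metis
  have "(\<lambda>n. \<integral>u. wulff_gauge (f n) u powr p * w u \<partial>\<sigma>) \<longlonglongrightarrow> (\<integral>u. wulff_gauge g u powr p * w u \<partial>\<sigma>)"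
  proof (rule integral_dominated_convergence)
    show "integrable \<sigma> (\<lambda>u. (1 / a) powr p * B)" by simp
    show "AE u in \<sigma>. (\<lambda>n. wulff_gauge (f n) u powr p * w u) \<longlonglongrightarrow> wulff_gauge g u powr p * w u"
    proof (rule AE_I2)
      fix u assume "u \<in> space \<sigma>"
      then have u: "u \<in> usphere" by (simp only: \<sigma>.space_M)
      then have "wulff_gauge g u \<noteq> 0"
        using pos_contD[OF pos_cont_wulff_gauge[OF g] u] by simp
      then show "(\<lambda>n. wulff_gauge (f n) u powr p * w u) \<longlonglongrightarrow> wulff_gauge g u powr p * w u"
        using limw[OF u] by (intro tendsto_intros) auto
    qed
    fix n
    show "AE u in \<sigma>. norm (wulff_gauge (f n) u powr p * w u) \<le> (1 / a) powr p * B"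
    proof (rule AE_I2)
      fix u assume "u \<in> space \<sigma>"
      then have u: "u \<in> usphere" by (simp only: \<sigma>.space_M)
      have "wulff_gauge (f n) u powr p * w u \<le> (1 / a) powr p * B"
        using wulff_gauge_le[OF f a lower(1), of n u] u pos_contD[OF pos_cont_wulff_gauge[OF f] u, of n]
          pos_contD[OF w u] B(2)[OF u] p
        by (intro mult_mono powr_mono2) auto
      then show "norm (wulff_gauge (f n) u powr p * w u) \<le> (1 / a) powr p * B"
        using pos_contD[OF w u] by (simp add: abs_mult)
    qed
  qed (intro borel_measurable_integrable integrable_powr_weight pos_cont_wulff_gauge f g)+
  moreover have "(\<lambda>n. \<integral>v. ln (f n v) \<partial>\<mu>) \<longlonglongrightarrow> (\<integral>v. ln (g v) \<partial>\<mu>)"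
  proof (rule integral_dominated_convergence)
    show "integrable \<mu> (\<lambda>u. \<bar>ln a\<bar> + \<bar>ln b\<bar>)" by simp
    show "AE u in \<mu>. (\<lambda>n. ln (f n u)) \<longlonglongrightarrow> ln (g u)"
    proof (rule AE_I2)
      fix u assume "u \<in> space \<mu>"
      then have u: "u \<in> usphere" by (simp only: \<mu>.space_M)
      then show "(\<lambda>n. ln (f n u)) \<longlonglongrightarrow> ln (g u)"
        using lim[OF u] pos_contD[OF g u] by (intro tendsto_ln) auto
    qed
    fix n
    show "AE u in \<mu>. norm (ln (f n u)) \<le> \<bar>ln a\<bar> + \<bar>ln b\<bar>"
    proof (rule AE_I2)
      fix u assume "u \<in> space \<mu>"
      then have u: "u \<in> usphere" by (simp only: \<mu>.space_M)
      have "ln a \<le> ln (f n u)" "ln (f n u) \<le> ln b"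
        using lower(1)[OF u, of n] upper[OF u, of n] a by (auto intro!: ln_mono)
      then show "norm (ln (f n u)) \<le> \<bar>ln a\<bar> + \<bar>ln b\<bar>" by auto
    qed
  qed (intro borel_measurable_integrable integrable_ln f g)+
  ultimately show ?thesis
    unfolding energy_def using p by (intro tendsto_intros) auto
qed

text \<open>The direct method: double gauges of competitors of energy at most \<open>C\<close> form
  a uniformly bounded, equi-Lipschitz family, and limits from Arzela-Ascoli stay in the class
  \<open>G\<close>.\<close>

lemma energy_minimizer:
  obtains g where "pos_cont g" "\<And>f. pos_cont f \<Longrightarrow> energy g \<le> energy f"
proof -
  have pc1: "pos_cont (\<lambda>v::'a. 1)" by (simp add: pos_cont_def)
  \<comment> \<open>The energy of the constant function 1, whose Wulff shape is the unit ball,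
    serves as the reference level.\<close>
  define C where "C = energy (\<lambda>v. 1)"
  obtain a where a: "0 < a"
    "\<And>g v. pos_cont g \<Longrightarrow> energy g \<le> C \<Longrightarrow> v \<in> usphere \<Longrightarrow> a \<le> g v"
    using energy_bounded_imp_lower_bound[where C=C] by blast
  obtain r where r: "0 < r"
    "\<And>h u. pos_cont h \<Longrightarrow> energy (wulff_gauge h) \<le> C \<Longrightarrow> u \<in> usphere \<Longrightarrow> r \<le> h u"
    using energy_bounded_imp_polar_lower_bound[where C=C] by blast
  \<comment> \<open>The upper bound and the Lipschitz constant \<open>1 / r\<close> come from the
    lower bound \<open>r\<close> on the gauge of a competitor.\<close>
  define G where "G = {g :: 'a \<Rightarrow> real. (\<forall>v\<in>usphere. a \<le> g v \<and> g v \<le> 1 / r) \<and>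
     (\<forall>u\<in>usphere. \<forall>v\<in>usphere. \<bar>g u - g v\<bar> \<le> norm (u - v) / r)}"
  have G_pc: "pos_cont g" if "g \<in> G" for g
  proof -
    have "(1/r)-lipschitz_on usphere g"
      using r that by (intro lipschitz_onI) (auto simp: G_def dist_norm)
    then show ?thesis
      using that a by (auto simp: pos_cont_def G_def lipschitz_on_continuous_on less_le_trans)
  qed
  have reduce: "wulff_gauge (wulff_gauge f) \<in> G" if f: "pos_cont f" "energy f \<le> C" for f
  proof -
    note pc = pos_cont_wulff_gauge[OF f(1)]
    have le: "energy (wulff_gauge (wulff_gauge f)) \<le> C"
      using energy_wulff_gauge_twice[OF f(1)] f(2) by simp
    note rr = r(2)[OF pc le]
    have "wulff_gauge (wulff_gauge f) u \<le> 1 / r" if "u \<in> usphere" for u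
    proof -
      have "wulff_gauge (wulff_gauge f) u \<le> norm u / r"
        by (rule wulff_gauge_le[OF pc r(1)]) (rule rr)
      then show ?thesis using that by simp
    qed
    moreover have "\<bar>wulff_gauge (wulff_gauge f) u - wulff_gauge (wulff_gauge f) v\<bar> \<le> norm (u - v) / r" for u v
      by (rule wulff_gauge_lipschitz[OF pc r(1)]) (rule rr)
    ultimately show ?thesis
      using a(2)[OF pos_cont_wulff_gauge[OF pc] le] by (auto simp: G_def)
  qed
  have G0: "wulff_gauge (wulff_gauge (\<lambda>v. 1)) \<in> G"
    by (rule reduce[OF pc1]) (simp add: C_def)
  \<comment> \<open>The power term is nonnegative and \<open>g\<close> is at least \<open>a\<close>,
    so the infimum over \<open>G\<close> is finite.\<close>
  have below: "(ln a) * measure \<mu> (space \<mu>) \<le> energy g" if "g \<in> G" for g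
  proof -
    have "(ln a) * measure \<mu> (space \<mu>) = (\<integral>v. ln a \<partial>\<mu>)" by simp
    also have "\<dots> \<le> (\<integral>v. ln (g v) \<partial>\<mu>)"
    proof (rule integral_mono)
      fix v assume "v \<in> space \<mu>"
      then have "v \<in> usphere" by (simp only: \<mu>.space_M)
      then show "ln a \<le> ln (g v)" using that a by (intro ln_mono) (auto simp: G_def)
    qed (use integrable_ln[OF G_pc[OF that]] in auto)
    also have "\<dots> \<le> energy g"
      unfolding energy_def using p pos_contD[OF w]
      by (auto intro!: divide_nonneg_nonneg Bochner_Integration.integral_nonneg simp: \<sigma>.space_M less_imp_le)
    finally show ?thesis .
  qed
  have bdd: "bdd_below (energy ` G)" using below by (auto simp: bdd_below_def)
  define m where "m = Inf (energy ` G)"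
  have "\<exists>g\<in>G. energy g < m + 1 / Suc n" for n
    using cInf_lessD[of "energy ` G" "m + 1 / Suc n"] G0 by (auto simp: m_def)
  then obtain f where f: "\<And>n. f n \<in> G" "\<And>n. energy (f n) < m + 1 / Suc n" by metis
  have "norm (f n u) \<le> 1 / r" if "u \<in> usphere" for n u
    using f(1)[of n] that a by (auto simp: G_def dest!: bspec)
  moreover have "\<exists>d. 0 < d \<and> (\<forall>n v. v \<in> usphere \<and> norm (u - v) < d \<longrightarrow> norm (f n u - f n v) < e)"
    if u: "u \<in> usphere" and "0 < e" for u e
  proof (intro exI[of _ "e * r"] conjI allI impI)
    show "0 < e * r" using that r by simp
    fix n v assume v: "v \<in> usphere \<and> norm (u - v) < e * r"
    have "norm (f n u - f n v) \<le> norm (u - v) / r"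
      using f(1)[of n] u v by (auto simp: G_def)
    also have "\<dots> < e" using v r by (simp add: pos_divide_less_eq)
    finally show "norm (f n u - f n v) < e" .
  qed
  ultimately obtain g k where g: "continuous_on usphere g" "strict_mono (k :: nat \<Rightarrow> nat)"
    "\<And>e. 0 < e \<Longrightarrow> \<exists>N. \<forall>n x. n \<ge> N \<and> x \<in> usphere \<longrightarrow> norm (f (k n) x - g x) < e"
    by (rule Arzela_Ascoli[OF compact_sphere, of 0 1 f "1 / r"]) blast+
  have lim: "(\<lambda>n. f (k n) u) \<longlonglongrightarrow> g u" if "u \<in> usphere" for u
    unfolding lim_sequentially dist_norm using g(3) that by meson
  have gG: "g \<in> G"
    unfolding G_def
  proof (intro CollectI conjI ballI)
    fix u :: 'a assume u: "u \<in> usphere"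
    show "a \<le> g u" using f(1) u by (intro LIMSEQ_le_const[OF lim[OF u]]) (auto simp: G_def)
    show "g u \<le> 1 / r" using f(1) u by (intro LIMSEQ_le_const2[OF lim[OF u]]) (auto simp: G_def)
    fix v :: 'a assume v: "v \<in> usphere"
    have "(\<lambda>n. \<bar>f (k n) u - f (k n) v\<bar>) \<longlonglongrightarrow> \<bar>g u - g v\<bar>"
      by (intro tendsto_intros lim u v)
    then show "\<bar>g u - g v\<bar> \<le> norm (u - v) / r"
      using f(1) u v by (intro LIMSEQ_le_const2) (auto simp: G_def)
  qed
  have "(\<lambda>n. energy (f (k n))) \<longlonglongrightarrow> energy g"
  proof (rule energy_tendsto[where a=a and b="1 / r"])
    show "pos_cont (f (k n))" for n by (rule G_pc[OF f(1)])
    show "pos_cont g" by (rule G_pc[OF gG])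
    show "\<exists>N. \<forall>n\<ge>N. \<forall>u\<in>usphere. \<bar>f (k n) u - g u\<bar> < e" if "0 < e" for e
      using g(3)[OF that] by (metis real_norm_def)
  qed (use a f(1) gG in \<open>auto simp: G_def\<close>)
  moreover have "(\<lambda>n. m + 1 / Suc (k n)) \<longlonglongrightarrow> m + 0"
    using LIMSEQ_subseq_LIMSEQ[OF LIMSEQ_inverse_real_of_nat g(2)]
    by (intro tendsto_intros) (simp add: o_def inverse_eq_divide)
  ultimately have "energy g \<le> m"
    using f(2) by (intro LIMSEQ_le[of "\<lambda>n. energy (f (k n))" _ "\<lambda>n. m + 1 / Suc (k n)"]) (auto intro: less_imp_le)
  then have min: "energy g \<le> energy f" if "f \<in> G" for f
    using cInf_lower[OF imageI[OF that] bdd] by (simp add: m_def)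
  show thesis
  proof (rule that[OF G_pc[OF gG]])
    fix f :: "'a \<Rightarrow> real" assume f: "pos_cont f"
    show "energy g \<le> energy f"
    proof (cases "energy f \<le> C")
      case True
      then show ?thesis
        using min[OF reduce[OF f True]] energy_wulff_gauge_twice[OF f] by simp
    next
      \<comment> \<open>A competitor above the reference level is beaten by the constant function
        1.\<close>
      case False
      then show ?thesis
        using min[OF G0] energy_wulff_gauge_twice[OF pc1] by (simp add: C_def)
    qed
  qed
qed

end

section \<open>Almost everywhere uniqueness of normals\<close>

text \<open>For positive \<open>d\<close> the intervals from \<open>s t\<close> to
  \<open>s' t\<close> have length at least \<open>d\<close>, lie between \<open>- L\<close> and
  \<open>B\<close>, and are stacked in the order of \<open>t\<close>; so their lengths add up to at
  most \<open>B + L\<close>.\<close>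

lemma card_jumps_le:
  fixes s s' :: "'a::linorder \<Rightarrow> real" and B L d :: real
  assumes "finite T" "0 \<le> B + L"
    and "\<And>t. t \<in> T \<Longrightarrow> s t + d \<le> s' t" "\<And>t. t \<in> T \<Longrightarrow> - L \<le> s t" "\<And>t. t \<in> T \<Longrightarrow> s' t \<le> B"
    and "\<And>t t'. t \<in> T \<Longrightarrow> t' \<in> T \<Longrightarrow> t < t' \<Longrightarrow> s' t \<le> s t'"
  shows "real (card T) * d \<le> B + L"
  using assms
proof (induction T arbitrary: B rule: finite_linorder_max_induct)
  case (insert b T)
  \<comment> \<open>All upper ends with index below the largest index \<open>b\<close> are at most
    \<open>s b\<close>, which takes the place of \<open>B\<close> in the induction
    hypothesis.\<close>
  have "real (card T) * d \<le> s b + L"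
    using insert.prems insert.hyps by (intro insert.IH) force+
  moreover have "b \<notin> T" using insert.hyps by auto
  ultimately show ?case
    using insert.hyps insert.prems(2,4)[of b] by (simp add: algebra_simps)
qed simp

text \<open>Averaging over translates replaces the use of Fubini's theorem on the lines in direction \<open>e\<close>.\<close>

lemma null_sets_if_few_translates:
  fixes D :: "'a::euclidean_space set"
  assumes D: "compact D" and few: "\<And>x J. card {j. j < J \<and> x + (real j / real J) *\<^sub>R e \<in> D} \<le> C"
  shows "D \<in> null_sets lborel"
proof -
  obtain M where M: "D \<subseteq> cball 0 M" "0 < M"
    using compact_imp_bounded[OF D] bounded_subset_ballD ball_subset_cball by (metis subset_trans)
  \<comment> \<open>Every point that one of the shifts moves into \<open>D\<close> lies in this
    ball, as the shifts have length at most \<open>norm e\<close>.\<close>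
  define K where "K = cball (0::'a) (M + norm e)"
  have K: "compact K" by (simp add: K_def)
  have intK: "integrable lborel (indicator K :: 'a \<Rightarrow> real)"
    using emeasure_compact_finite[OF K] K by (simp add: integrable_indicator_iff borel_compact)
  \<comment> \<open>This integrates over \<open>x\<close> the number of shifts that move
    \<open>x\<close> into \<open>D\<close>: each set \<open>T j\<close> has the measure of
    \<open>D\<close>, and at most \<open>C\<close> of them overlap at any point. Letting
    \<open>J\<close> grow shows that \<open>D\<close> is null.\<close>
  have bound: "real J * measure lborel D \<le> real C * measure lborel K" for J
  proof -
    define T where "T j = {x. x + (real j / real J) *\<^sub>R e \<in> D}" for j :: nat
    have T_eq: "T j = (+) ((real j / real J) *\<^sub>R e) -` D" for j
      by (auto simp: T_def add.commute)
    have T_sets: "T j \<in> sets borel" for j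
      using measurable_sets[of "(+) ((real j / real J) *\<^sub>R e)" borel borel D] D
      by (simp add: T_eq borel_compact)
    have T_measure: "emeasure lborel (T j) = emeasure lborel D" for j
    proof -
      have "emeasure lborel D = emeasure (distr lborel borel ((+) ((real j / real J) *\<^sub>R e))) D"
        by (simp add: lborel_distr_plus)
      also have "\<dots> = emeasure lborel (T j)"
        using D by (subst emeasure_distr) (auto simp: T_eq borel_compact)
      finally show ?thesis by simp
    qed
    have intT: "integrable lborel (indicator (T j) :: 'a \<Rightarrow> real)" for j
      using T_sets[of j] emeasure_compact_finite[OF D] by (simp add: integrable_indicator_iff T_measure)
    have "real J * measure lborel D = (\<Sum>j<J. measure lborel (T j))"
      by (simp add: measure_def T_measure)
    also have "\<dots> = (\<integral>x. (\<Sum>j<J. indicat_real (T j) x) \<partial>lborel)"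
      using intT by (subst Bochner_Integration.integral_sum) auto
    also have "\<dots> \<le> (\<integral>x. real C * indicator K x \<partial>lborel)"
    proof (rule integral_mono)
      fix x :: 'a
      have eq: "(\<Sum>j<J. indicat_real (T j) x) = real (card {j. j < J \<and> x + (real j / real J) *\<^sub>R e \<in> D})"
      proof -
        have "{..<J} \<inter> {j. x \<in> T j} = {j. j < J \<and> x + (real j / real J) *\<^sub>R e \<in> D}"
          by (auto simp: T_def)
        then show ?thesis by (simp add: indicator_def)
      qed
      show "(\<Sum>j<J. indicat_real (T j) x) \<le> real C * indicator K x"
      proof (cases "x \<in> K")
        case True
        then show ?thesis unfolding eq using few[of J x] by simp
      next
        case False
        have "x + (real j / real J) *\<^sub>R e \<notin> D" if "j < J" for j
        proof
          assume "x + (real j / real J) *\<^sub>R e \<in> D"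
          then have "norm (x + (real j / real J) *\<^sub>R e) \<le> M" using M by auto
          moreover have "norm ((real j / real J) *\<^sub>R e) \<le> norm e"
            using that mult_left_le_one_le[of "norm e" "real j / real J"] by simp
          moreover have "norm x \<le> norm (x + (real j / real J) *\<^sub>R e) + norm ((real j / real J) *\<^sub>R e)"
            by (metis add_diff_cancel_right' norm_triangle_ineq4)
          ultimately show False using False by (simp add: K_def)
        qed
        then have em: "{j. j < J \<and> x + (real j / real J) *\<^sub>R e \<in> D} = {}" by blast
        show ?thesis unfolding eq em by simp
      qed
    qed (use intT intK in auto)
    also have "\<dots> = real C * measure lborel K" using K by (simp add: borel_compact)
    finally show ?thesis .
  qed
  have "measure lborel D = 0"
  proof (rule ccontr)
    assume "measure lborel D \<noteq> 0"
    then have "0 < measure lborel D" by (simp add: zero_less_measure_iff)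
    then obtain J where "real C * measure lborel K < real J * measure lborel D"
      using reals_Archimedean3 by blast
    then show False using bound[of J] by simp
  qed
  then show ?thesis
    using D emeasure_compact_finite[OF D] by (auto simp: null_sets_def borel_compact emeasure_eq_ennreal_measure)
qed

text \<open>For the positively homogeneous function \<open>wulff_gauge g\<close> this is equivalent to the usual definition
  of a subgradient at \<open>x\<close>.\<close>

definition wulff_subgradient :: "('a::euclidean_space \<Rightarrow> real) \<Rightarrow> 'a \<Rightarrow> 'a \<Rightarrow> bool" where
  "wulff_subgradient g x s \<longleftrightarrow> (\<forall>y. s \<bullet> y \<le> wulff_gauge g y) \<and> s \<bullet> x = wulff_gauge g x"

lemma wulff_subgradient_norm_le:
  assumes "pos_cont g" "0 < a" "\<And>u. u \<in> usphere \<Longrightarrow> a \<le> g u" "wulff_subgradient g x s"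
  shows "norm s \<le> 1 / a"
proof -
  have "s \<bullet> s \<le> norm s / a"
    using assms(4) wulff_gauge_le[OF assms(1-3), of s] unfolding wulff_subgradient_def
    by (meson order_trans)
  then have "norm s * norm s \<le> norm s * (1 / a)" by (simp add: dot_square_norm power2_eq_square)
  then show ?thesis
    using assms(2) by (cases "s = 0") (auto intro: mult_left_le_imp_le)
qed

lemma wulff_subgradient_mono:
  assumes "wulff_subgradient g x s" "wulff_subgradient g y s'"
  shows "0 \<le> (s' - s) \<bullet> (y - x)"
proof -
  have "s \<bullet> y \<le> s' \<bullet> y" "s' \<bullet> x \<le> s \<bullet> x"
    using assms unfolding wulff_subgradient_def by metis+
  then show ?thesis by (simp add: inner_diff_left inner_diff_right)
qed

lemma wulff_subgradient_scale:
  assumes "pos_cont g" "0 < c"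
  shows "wulff_subgradient g (c *\<^sub>R x) s \<longleftrightarrow> wulff_subgradient g x s"
  using assms by (auto simp: wulff_subgradient_def wulff_gauge_scale)

text \<open>The fixed gap \<open>1 / Suc k\<close> makes the set closed; the union over
  \<open>k\<close> and over the basis vectors \<open>e\<close> collects all points of the unit ball
  with more than one subgradient.\<close>

definition gradient_jump :: "('a::euclidean_space \<Rightarrow> real) \<Rightarrow> 'a \<Rightarrow> nat \<Rightarrow> 'a set" where
  "gradient_jump g e k = {x \<in> cball 0 1. \<exists>s s'. wulff_subgradient g x s \<and> wulff_subgradient g x s' \<and>
     s \<bullet> e + 1 / Suc k \<le> s' \<bullet> e}"

text \<open>The set is a projection of a closed set of triples \<open>(x, s, s')\<close>, and
  compactness holds because subgradients have norm at most \<open>1 / a\<close>.\<close>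

lemma compact_gradient_jump:
  assumes g: "pos_cont g"
  shows "compact (gradient_jump g e k)"
proof -
  obtain a where a: "0 < a" "\<And>u. u \<in> usphere \<Longrightarrow> a \<le> g u"
    using pos_cont_lower[OF g] by metis
  define W where "W = {(x, s, s'). wulff_subgradient g x s \<and> wulff_subgradient g x s' \<and>
     s \<bullet> e + 1 / Suc k \<le> s' \<bullet> e}"
  have cont: "continuous_on UNIV (wulff_gauge g \<circ> fst)"
    by (intro continuous_on_compose continuous_on_wulff_gauge g continuous_intros)
  have "closed W"
    unfolding W_def wulff_subgradient_def case_prod_beta
    by (intro closed_Collect_conj closed_Collect_all closed_Collect_le closed_Collect_eq
        cont[unfolded o_def] continuous_intros)
  then have "compact ((cball 0 1 \<times> cball 0 (1/a) \<times> cball 0 (1/a)) \<inter> W)"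
    by (intro compact_Int_closed compact_Times compact_cball)
  then have "compact (fst ` ((cball 0 1 \<times> cball 0 (1/a) \<times> cball 0 (1/a)) \<inter> W))"
    by (intro compact_continuous_image continuous_intros)
  also have "fst ` ((cball 0 1 \<times> cball 0 (1/a) \<times> cball 0 (1/a)) \<inter> W) = gradient_jump g e k"
  proof (intro set_eqI iffI)
    fix x assume "x \<in> gradient_jump g e k"
    then obtain s s' where s: "x \<in> cball 0 1" "(x, s, s') \<in> W"
      by (auto simp: gradient_jump_def W_def)
    then have "norm s \<le> 1 / a" "norm s' \<le> 1 / a"
      using wulff_subgradient_norm_le[OF g a] unfolding W_def by blast+
    then have "(x, s, s') \<in> (cball 0 1 \<times> cball 0 (1/a) \<times> cball 0 (1/a)) \<inter> W"
      using s by simp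
    then show "x \<in> fst ` ((cball 0 1 \<times> cball 0 (1/a) \<times> cball 0 (1/a)) \<inter> W)"
      by (metis fst_conv image_eqI)
  next
    fix x assume "x \<in> fst ` ((cball 0 1 \<times> cball 0 (1/a) \<times> cball 0 (1/a)) \<inter> W)"
    then show "x \<in> gradient_jump g e k"
      unfolding W_def gradient_jump_def by auto blast
  qed
  finally show ?thesis .
qed

text \<open>Along a line in direction \<open>e\<close> the components \<open>s \<bullet> e\<close>
  of subgradients are monotone and bounded by \<open>1 / a\<close> in absolute value, so jumps of
  size \<open>1 / Suc k\<close> occur at no more than \<open>2 / a * Suc k\<close> points.\<close>

lemma null_sets_gradient_jump:
  assumes g: "pos_cont g" and e: "e \<in> Basis"
  shows "gradient_jump g e k \<in> null_sets lborel"
proof -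
  obtain a where a: "0 < a" "\<And>u. u \<in> usphere \<Longrightarrow> a \<le> g u"
    using pos_cont_lower[OF g] by metis
  define C where "C = nat \<lceil>2 / a * Suc k\<rceil>"
  show ?thesis
  proof (rule null_sets_if_few_translates[OF compact_gradient_jump[OF g]])
    fix x J
    let ?T = "{j. j < J \<and> x + (real j / real J) *\<^sub>R e \<in> gradient_jump g e k}"
    define Q where "Q j s s' \<longleftrightarrow> wulff_subgradient g (x + (real j / real J) *\<^sub>R e) s \<and>
       wulff_subgradient g (x + (real j / real J) *\<^sub>R e) s' \<and> s \<bullet> e + 1 / Suc k \<le> s' \<bullet> e" for j s s'
    have "\<forall>j\<in>?T. \<exists>s. \<exists>s'. Q j s s'"
      unfolding gradient_jump_def Q_def by blast
    from bchoice[OF this] obtain s where "\<forall>j\<in>?T. \<exists>s'. Q j (s j) s'" ..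
    from bchoice[OF this] obtain s' where Q: "\<forall>j\<in>?T. Q j (s j) (s' j)" ..
    have s: "wulff_subgradient g (x + (real j / real J) *\<^sub>R e) (s j) \<and>
       wulff_subgradient g (x + (real j / real J) *\<^sub>R e) (s' j) \<and> s j \<bullet> e + 1 / Suc k \<le> s' j \<bullet> e"
      if "j \<in> ?T" for j
      using Q that unfolding Q_def by blast
    have "card ?T * (1 / Suc k) \<le> 1 / a + 1 / a"
    proof (rule card_jumps_le[where s="\<lambda>j. s j \<bullet> e" and s'="\<lambda>j. s' j \<bullet> e"])
      fix j assume j: "j \<in> ?T"
      show "s j \<bullet> e + 1 / Suc k \<le> s' j \<bullet> e" using s[OF j] by blast
      have "\<bar>s j \<bullet> e\<bar> \<le> 1 / a" "\<bar>s' j \<bullet> e\<bar> \<le> 1 / a"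
        using wulff_subgradient_norm_le[OF g a] s[OF j] Basis_le_norm[OF e] by (meson order_trans)+
      then show "- (1 / a) \<le> s j \<bullet> e" "s' j \<bullet> e \<le> 1 / a" by auto
      fix j' assume j': "j' \<in> ?T" "j < j'"
      have "0 \<le> (s j' - s' j) \<bullet> ((x + (real j' / real J) *\<^sub>R e) - (x + (real j / real J) *\<^sub>R e))"
        using s[OF j] s[OF j'(1)] by (intro wulff_subgradient_mono) auto
      also have "\<dots> = (real j' / real J - real j / real J) * ((s j' - s' j) \<bullet> e)"
        by (simp add: algebra_simps inner_diff_right inner_diff_left)
      finally have "0 \<le> (real j' / real J - real j / real J) * ((s j' - s' j) \<bullet> e)" .
      moreover have "0 < real j' / real J - real j / real J"
        using j j' by (auto simp: divide_strict_right_mono)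
      ultimately show "s' j \<bullet> e \<le> s j' \<bullet> e"
        by (simp add: zero_le_mult_iff inner_diff_left)
    qed (use a in auto)
    then have "real (card ?T) \<le> 2 / a * Suc k" by (simp add: field_simps)
    then show "card ?T \<le> C" unfolding C_def by linarith
  qed
qed

section \<open>Singular directions form a null set\<close>

definition singular_directions :: "('a::euclidean_space \<Rightarrow> real) \<Rightarrow> 'a set" where
  "singular_directions g =
     {u \<in> usphere. \<exists>s s'. s \<noteq> s' \<and> wulff_subgradient g u s \<and> wulff_subgradient g u s'}"

text \<open>Distinct subgradients differ in some coordinate, and by at least some
  \<open>1 / Suc k\<close> after exchanging them if necessary.\<close>

lemma nonunique_iff_gradient_jump:
  assumes "x \<in> cball 0 1"
  shows "(\<exists>s s'. s \<noteq> s' \<and> wulff_subgradient g x s \<and> wulff_subgradient g x s') \<longleftrightarrow>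
    x \<in> (\<Union>e\<in>Basis. \<Union>k. gradient_jump g e k)"
proof
  assume "\<exists>s s'. s \<noteq> s' \<and> wulff_subgradient g x s \<and> wulff_subgradient g x s'"
  then obtain s s' where s: "s \<noteq> s'" "wulff_subgradient g x s" "wulff_subgradient g x s'" by blast
  then obtain e where e: "e \<in> Basis" "s \<bullet> e \<noteq> s' \<bullet> e" by (meson euclidean_eqI)
  then have "0 < \<bar>s \<bullet> e - s' \<bullet> e\<bar>" by simp
  then obtain k where "inverse (real (Suc k)) < \<bar>s \<bullet> e - s' \<bullet> e\<bar>"
    using reals_Archimedean by blast
  then have "s \<bullet> e + 1 / Suc k \<le> s' \<bullet> e \<or> s' \<bullet> e + 1 / Suc k \<le> s \<bullet> e"
    by (auto simp: inverse_eq_divide)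
  then show "x \<in> (\<Union>e\<in>Basis. \<Union>k. gradient_jump g e k)"
    using s e assms unfolding gradient_jump_def by blast
next
  assume "x \<in> (\<Union>e\<in>Basis. \<Union>k. gradient_jump g e k)"
  then obtain e k s s' where "wulff_subgradient g x s" "wulff_subgradient g x s'"
     "s \<bullet> e + 1 / Suc k \<le> s' \<bullet> e" unfolding gradient_jump_def by blast
  moreover from this have "s \<noteq> s'" by (auto simp: field_simps)
  ultimately show "\<exists>s s'. s \<noteq> s' \<and> wulff_subgradient g x s \<and> wulff_subgradient g x s'" by blast
qed

lemma singular_directions_borel:
  assumes "pos_cont g"
  shows "singular_directions g \<in> sets borel"
proof -
  have "x \<in> singular_directions g \<longleftrightarrow> x \<in> usphere \<and> x \<in> (\<Union>e\<in>Basis. \<Union>k. gradient_jump g e k)" for x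
    using nonunique_iff_gradient_jump[of x g] unfolding singular_directions_def mem_Collect_eq
    by (metis mem_cball_0 mem_sphere_0 order_refl)
  then have "singular_directions g = usphere \<inter> (\<Union>e\<in>Basis. \<Union>k. gradient_jump g e k)"
    by blast
  moreover have "gradient_jump g e k \<in> sets borel" for e k
    using compact_gradient_jump[OF assms] by (rule borel_compact)
  then have "(\<Union>e\<in>Basis. \<Union>k. gradient_jump g e k) \<in> sets borel"
    by (intro sets.finite_UN sets.countable_UN finite_Basis) auto
  ultimately show ?thesis
    using sets.Int[of usphere borel] borel_closed[OF closed_sphere] by simp
qed

text \<open>Subgradients are constant along rays, so the cone over the singular directions within
  the unit ball consists of points of nonuniqueness.\<close>

lemma null_sets_singular_directions:
  assumes g: "pos_cont g"
  shows "singular_directions g \<in> null_sets sphere_measure"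
proof (rule null_sphere_measureI[OF singular_directions_borel[OF g]])
  show "{x \<in> cball 0 1 - {0}. x /\<^sub>R norm x \<in> singular_directions g}
    \<subseteq> (\<Union>e\<in>Basis. \<Union>k. gradient_jump g e k)"
  proof
    fix x assume x: "x \<in> {x \<in> cball 0 1 - {0}. x /\<^sub>R norm x \<in> singular_directions g}"
    then have "\<exists>s s'. s \<noteq> s' \<and> wulff_subgradient g x s \<and> wulff_subgradient g x s'"
      using wulff_subgradient_scale[OF g, of "inverse (norm x)" x]
      by (auto simp: singular_directions_def)
    then show "x \<in> (\<Union>e\<in>Basis. \<Union>k. gradient_jump g e k)"
      using nonunique_iff_gradient_jump[of x g] x by auto
  qed
  show "(\<Union>e\<in>Basis. \<Union>k. gradient_jump g e k) \<in> null_sets lborel"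
    using null_sets_gradient_jump[OF g] by (intro null_sets_UN') (auto intro: countable_finite)
qed (auto simp: singular_directions_def)

text \<open>Off the regular directions this is a constant, which makes the function Borel measurable.\<close>

definition wulff_normal :: "('a::euclidean_space \<Rightarrow> real) \<Rightarrow> 'a \<Rightarrow> 'a" where
  "wulff_normal g u = (SOME v. v \<in> usphere \<and> (u \<in> usphere - singular_directions g \<longrightarrow> wulff_gauge g u = (u \<bullet> v) / g v))"

lemma wulff_normal:
  assumes "pos_cont g"
  shows wulff_normal_in_usphere: "wulff_normal g u \<in> usphere"
    and wulff_gauge_wulff_normal:
      "u \<in> usphere - singular_directions g \<Longrightarrow> wulff_gauge g u = (u \<bullet> wulff_normal g u) / g (wulff_normal g u)"
proof -
  have "\<exists>v. v \<in> usphere \<and> (u \<in> usphere - singular_directions g \<longrightarrow> wulff_gauge g u = (u \<bullet> v) / g v)"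
    using wulff_gauge_attained[OF assms, of u] by metis
  from someI_ex[OF this]
  show "wulff_normal g u \<in> usphere"
    "u \<in> usphere - singular_directions g \<Longrightarrow> wulff_gauge g u = (u \<bullet> wulff_normal g u) / g (wulff_normal g u)"
    unfolding wulff_normal_def by auto
qed

section \<open>The normal map at regular directions\<close>

lemma wulff_subgradient_maximizer:
  assumes "pos_cont g" "v \<in> usphere" "wulff_gauge g u = (u \<bullet> v) / g v"
  shows "wulff_subgradient g u (v /\<^sub>R g v)"
  using wulff_gauge_upper[OF assms(1,2)] assms(3)
  by (simp add: wulff_subgradient_def inner_commute divide_inverse mult.commute)

text \<open>Uniqueness of the subgradient identifies \<open>c *\<^sub>R v\<close> with the chosen
  normal divided by its \<open>g\<close>-value; comparing norms shows that the two positive factors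
  agree.\<close>

lemma wulff_normal_unique:
  assumes "pos_cont g" "u \<in> usphere - singular_directions g" "v \<in> usphere" "0 < c"
    and "wulff_subgradient g u (c *\<^sub>R v)"
  shows "v = wulff_normal g u"
proof -
  let ?w = "wulff_normal g u"
  have w: "?w \<in> usphere" "wulff_subgradient g u (?w /\<^sub>R g ?w)"
    using wulff_normal[OF assms(1), of u] wulff_subgradient_maximizer[OF assms(1)] assms(2) by auto
  then have eq: "c *\<^sub>R v = ?w /\<^sub>R g ?w"
    using assms(2,5) by (auto simp: singular_directions_def)
  have "norm (c *\<^sub>R v) = norm (?w /\<^sub>R g ?w)" by (simp add: eq)
  then have "c = inverse (g ?w)"
    using assms(3,4) w(1) pos_contD[OF assms(1) w(1)] by simp
  then show ?thesis using eq assms(4) by (metis less_irrefl scaleR_left_imp_eq)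
qed

text \<open>Closed graph theorem with compact range: by uniqueness of the maximizer, the graph is
  the zero set of the continuous function \<open>f\<close>.\<close>

lemma continuous_on_wulff_normal:
  assumes g: "pos_cont g"
  shows "continuous_on (usphere - singular_directions g) (wulff_normal g)"
proof -
  define A where "A = usphere - singular_directions g"
  define P where "P = A \<times> (usphere :: 'a set)"
  define f where "f = (\<lambda>z. wulff_gauge g (fst z) - (fst z \<bullet> snd z) / g (snd z))"
  have "continuous_on P (\<lambda>z. g (snd z))"
    using g by (intro continuous_on_compose2[of usphere g P snd] continuous_intros) (auto simp: pos_cont_def P_def)
  moreover have "continuous_on P (\<lambda>z. wulff_gauge g (fst z))"
    by (rule continuous_on_compose2[OF continuous_on_wulff_gauge[OF g, of UNIV]]) (intro continuous_intros | simp)+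
  moreover have "\<forall>z\<in>P. g (snd z) \<noteq> 0"
    using pos_contD[OF g] unfolding P_def by (metis less_irrefl mem_Times_iff)
  ultimately have "continuous_on P f"
    unfolding f_def by (intro continuous_intros)
  then have "closedin (top_of_set P) {z \<in> P. f z = 0}"
    by (rule continuous_closedin_preimage_constant)
  also have "{z \<in> P. f z = 0} = (\<lambda>x. (x, wulff_normal g x)) ` A"
  proof (intro set_eqI iffI)
    fix z assume "z \<in> {z \<in> P. f z = 0}"
    then have z: "fst z \<in> A" "snd z \<in> usphere" "wulff_gauge g (fst z) = (fst z \<bullet> snd z) / g (snd z)"
      by (auto simp: P_def f_def)
    have "snd z = wulff_normal g (fst z)"
    proof (rule wulff_normal_unique[OF g])
      show "wulff_subgradient g (fst z) (inverse (g (snd z)) *\<^sub>R snd z)"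
        by (rule wulff_subgradient_maximizer[OF g z(2,3)])
    qed (use z pos_contD[OF g z(2)] in \<open>simp_all add: A_def\<close>)
    then have "z = (fst z, wulff_normal g (fst z))" by (simp add: prod_eq_iff)
    then show "z \<in> (\<lambda>x. (x, wulff_normal g x)) ` A" using z(1) by (rule image_eqI)
  next
    fix z assume "z \<in> (\<lambda>x. (x, wulff_normal g x)) ` A"
    then obtain x where x: "x \<in> A" "z = (x, wulff_normal g x)" by blast
    then show "z \<in> {z \<in> P. f z = 0}"
      using wulff_normal[OF g, of x] by (simp add: P_def f_def A_def)
  qed
  finally have "continuous_on A (wulff_normal g)"
    unfolding P_def using wulff_normal_in_usphere[OF g]
    by (subst continuous_closed_graph_eq[OF compact_sphere]) auto
  then show ?thesis by (simp add: A_def)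
qed

lemma wulff_normal_measurable:
  assumes g: "pos_cont g"
  shows "wulff_normal g \<in> borel \<rightarrow>\<^sub>M borel"
proof -
  have "wulff_normal g = (\<lambda>u. if u \<in> usphere - singular_directions g then wulff_normal g u else (SOME v. v \<in> usphere))"
    by (auto simp: wulff_normal_def fun_eq_iff)
  moreover have "(\<lambda>u. if u \<in> usphere - singular_directions g then wulff_normal g u else (SOME v. v \<in> usphere))
     \<in> borel \<rightarrow>\<^sub>M borel"
    by (rule borel_measurable_continuous_on_if[OF sets.Diff[OF borel_closed[OF closed_sphere]
        singular_directions_borel[OF g]] continuous_on_wulff_normal[OF g] continuous_on_const])
  ultimately show ?thesis by simp
qed

lemma (in usphere_measure) measurable_wulff_normal:
  assumes "pos_cont g"
  shows "wulff_normal g \<in> M \<rightarrow>\<^sub>M restrict_space borel usphere"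
proof -
  have "wulff_normal g \<in> restrict_space borel usphere \<rightarrow>\<^sub>M restrict_space borel usphere"
    using wulff_normal_measurable[OF assms] wulff_normal_in_usphere[OF assms]
    by (intro measurable_restrict_space2 measurable_restrict_space1) auto
  then show ?thesis
    using measurable_cong_sets[OF sets_M refl] by blast
qed

section \<open>The first variation of the energy\<close>

lemma pos_cont_mult_exp:
  assumes "pos_cont g" "continuous_on usphere \<psi>"
  shows "pos_cont (\<lambda>v. g v * exp (- t * \<psi> v))"
  using assms by (auto simp: pos_cont_def intro!: continuous_intros)

lemma powr_exp_mult:
  fixes x y p :: real
  assumes "0 < x"
  shows "(x * exp y) powr p = x powr p * exp (p * y)"
  using assms by (simp add: powr_mult) (simp add: powr_def)

text \<open>Obtained by taking reciprocals in \<open>1 - y \<le> exp (- y)\<close>; it bounds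
  difference quotients of the power term from above.\<close>

lemma exp_le_one_plus_quotient:
  assumes "(y :: real) < 1"
  shows "exp y \<le> 1 + y / (1 - y)"
proof -
  have "1 - y \<le> exp (- y)" using exp_ge_add_one_self[of "- y"] by simp
  then have "exp y * (1 - y) \<le> exp y * exp (- y)" by (intro mult_left_mono) auto
  then have "exp y * (1 - y) \<le> 1" by (simp add: exp_minus)
  then show ?thesis using assms by (simp add: field_simps)
qed

text \<open>The maximizers \<open>v n\<close> of the perturbed gauges almost maximize the
  unperturbed quotient. If \<open>\<psi> (v n)\<close> stayed away from the limit,
  \<open>v n\<close> would lie in the compact set \<open>K\<close>, on which the quotient is bounded
  strictly below its maximum.\<close>

lemma maximizers_tendsto:
  assumes g: "pos_cont g" and \<psi>: "continuous_on usphere \<psi>" and u: "u \<in> usphere - singular_directions g"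
    and t: "t \<longlonglongrightarrow> 0" "\<And>n. 0 < t n" and v: "\<And>n. v n \<in> usphere"
    and max: "\<And>n. wulff_gauge (\<lambda>x. g x * exp (- t n * \<psi> x)) u = (u \<bullet> v n) / g (v n) * exp (t n * \<psi> (v n))"
    and B: "\<And>x. x \<in> usphere \<Longrightarrow> \<bar>\<psi> x\<bar> \<le> B"
  shows "(\<lambda>n. \<psi> (v n)) \<longlonglongrightarrow> \<psi> (wulff_normal g u)"
proof (rule tendstoI)
  let ?N = "wulff_normal g u"
  let ?k = "\<lambda>x. (u \<bullet> x) / g x"
  fix e :: real assume e: "0 < e"
  note N = wulff_normal_in_usphere[OF g, of u]
  have u': "u \<in> usphere" using u by simp
  note h = pos_contD[OF pos_cont_wulff_gauge[OF g] u']
  define K where "K = {x \<in> usphere. e \<le> \<bar>\<psi> x - \<psi> ?N\<bar>}"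
  have "closed K"
    unfolding K_def using \<psi> by (intro continuous_on_closed_Collect_le continuous_intros) auto
  moreover have "K \<subseteq> usphere" by (auto simp: K_def)
  ultimately have K: "compact K" using compact_sphere by (metis compact_Int_closed inf.absorb2)
  have "\<forall>x\<in>K. g x \<noteq> 0" using pos_contD[OF g] \<open>K \<subseteq> usphere\<close> by (metis less_irrefl subsetD)
  then have contk: "continuous_on K ?k"
    using g \<open>K \<subseteq> usphere\<close> unfolding pos_cont_def
    by (intro continuous_intros) (auto intro: continuous_on_subset)
  \<comment> \<open>Comparing \<open>v n\<close> with \<open>?N\<close> in the perturbed gauge costs
    at most the factor \<open>exp (- (2 * B * t n))\<close>, which tends to 1.\<close>
  have low: "wulff_gauge g u * exp (- (2 * B * t n)) \<le> ?k (v n)" for n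
  proof -
    have "(u \<bullet> ?N) / (g ?N * exp (- t n * \<psi> ?N)) \<le> wulff_gauge (\<lambda>x. g x * exp (- t n * \<psi> x)) u"
      by (rule wulff_gauge_upper[OF pos_cont_mult_exp[OF g \<psi>] N])
    then have "wulff_gauge g u * exp (t n * \<psi> ?N) \<le> ?k (v n) * exp (t n * \<psi> (v n))"
      using wulff_gauge_wulff_normal[OF g u] max[of n] by (simp add: exp_minus field_simps)
    then have "wulff_gauge g u * exp (t n * \<psi> ?N) * exp (- (t n * \<psi> (v n))) \<le> ?k (v n) * exp (t n * \<psi> (v n)) * exp (- (t n * \<psi> (v n)))"
      by (intro mult_right_mono) auto
    then have "wulff_gauge g u * exp (t n * \<psi> ?N - t n * \<psi> (v n)) \<le> ?k (v n)"
      by (simp add: exp_minus exp_diff divide_inverse mult_ac)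
    moreover have "- (2 * B * t n) \<le> t n * \<psi> ?N - t n * \<psi> (v n)"
    proof -
      have "t n * (- (2 * B)) \<le> t n * (\<psi> ?N - \<psi> (v n))"
        using B[OF N] B[OF v[of n]] t(2)[of n] by (intro mult_left_mono) auto
      then show ?thesis by (simp add: algebra_simps)
    qed
    then have "wulff_gauge g u * exp (- (2 * B * t n)) \<le> wulff_gauge g u * exp (t n * \<psi> ?N - t n * \<psi> (v n))"
      using h by (intro mult_left_mono) auto
    ultimately show ?thesis by linarith
  qed
  have "(\<lambda>n. wulff_gauge g u * exp (- (2 * B * t n))) \<longlonglongrightarrow> wulff_gauge g u * exp (- (2 * B * 0))"
    by (intro tendsto_intros t)
  then have lim: "(\<lambda>n. wulff_gauge g u * exp (- (2 * B * t n))) \<longlonglongrightarrow> wulff_gauge g u" by simp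
  show "\<forall>\<^sub>F n in sequentially. dist (\<psi> (v n)) (\<psi> ?N) < e"
  proof (cases "K = {}")
    case True
    then have "dist (\<psi> (v n)) (\<psi> ?N) < e" for n
      using v[of n] by (force simp: K_def dist_real_def)
    then show ?thesis by simp
  next
    case False
    obtain x where x: "x \<in> K" "\<And>y. y \<in> K \<Longrightarrow> ?k y \<le> ?k x"
      using continuous_attains_sup[OF K False contk] by blast
    \<comment> \<open>Equality would make \<open>x\<close> the unique maximizer \<open>?N\<close>,
      which does not belong to \<open>K\<close>.\<close>
    have "?k x < wulff_gauge g u"
    proof (rule ccontr)
      assume "\<not> ?k x < wulff_gauge g u"
      then have "wulff_gauge g u = ?k x"
        using wulff_gauge_upper[OF g, of x u] x(1) by (auto simp: K_def)
      then have "wulff_subgradient g u (x /\<^sub>R g x)"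
        using x(1) by (intro wulff_subgradient_maximizer[OF g]) (auto simp: K_def)
      then have "x = ?N"
        using x(1) pos_contD[OF g, of x] by (intro wulff_normal_unique[OF g u]) (auto simp: K_def)
      then show False using x(1) e by (simp add: K_def)
    qed
    then have "\<forall>\<^sub>F n in sequentially. ?k x < wulff_gauge g u * exp (- (2 * B * t n))"
      by (rule order_tendstoD(1)[OF lim])
    then show ?thesis
    proof (rule eventually_mono)
      fix n assume "?k x < wulff_gauge g u * exp (- (2 * B * t n))"
      then have "v n \<notin> K" using low[of n] x(2)[of "v n"] by force
      then show "dist (\<psi> (v n)) (\<psi> ?N) < e"
        using v[of n] by (simp add: K_def dist_real_def)
    qed
  qed
qed

context wulff_energy
begin

definition weight :: "('a \<Rightarrow> real) \<Rightarrow> 'a \<Rightarrow> real" where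
  "weight g u = wulff_gauge g u powr p * w u"

lemma weight_nonneg: "u \<in> usphere \<Longrightarrow> 0 \<le> weight g u"
  using pos_contD[OF w] by (simp add: weight_def less_imp_le)

lemma integrable_weight: "pos_cont g \<Longrightarrow> integrable \<sigma> (weight g)"
  unfolding weight_def by (intro integrable_powr_weight pos_cont_wulff_gauge)

text \<open>The unperturbed normal is a competitor in the perturbed gauge.\<close>

lemma weight_mult_exp_ge:
  assumes g: "pos_cont g" and \<psi>: "continuous_on usphere \<psi>" and u: "u \<in> usphere - singular_directions g"
  shows "weight g u * exp (p * (t * \<psi> (wulff_normal g u))) \<le> weight (\<lambda>v. g v * exp (- t * \<psi> v)) u"
proof -
  let ?N = "wulff_normal g u"
  have u': "u \<in> usphere" using u by simp
  note h = pos_contD[OF pos_cont_wulff_gauge[OF g] u']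
  have "wulff_gauge g u * exp (t * \<psi> ?N) = (u \<bullet> ?N) / (g ?N * exp (- t * \<psi> ?N))"
    using wulff_gauge_wulff_normal[OF g u] by (simp add: exp_minus field_simps)
  also have "\<dots> \<le> wulff_gauge (\<lambda>v. g v * exp (- t * \<psi> v)) u"
    by (rule wulff_gauge_upper[OF pos_cont_mult_exp[OF g \<psi>] wulff_normal_in_usphere[OF g]])
  finally have "(wulff_gauge g u * exp (t * \<psi> ?N)) powr p \<le> wulff_gauge (\<lambda>v. g v * exp (- t * \<psi> v)) u powr p"
    using h p by (intro powr_mono2) auto
  then have "wulff_gauge g u powr p * exp (p * (t * \<psi> ?N)) * w u
     \<le> wulff_gauge (\<lambda>v. g v * exp (- t * \<psi> v)) u powr p * w u"
    unfolding powr_exp_mult[OF h] using pos_contD[OF w u'] by (intro mult_right_mono) auto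
  then show ?thesis by (simp add: weight_def mult_ac)
qed

text \<open>Conversely, the maximizer of the perturbed gauge is a competitor in the unperturbed one.
  Its maximality is recorded in the form that \<open>maximizers_tendsto\<close> expects.\<close>

lemma weight_mult_exp_le:
  assumes g: "pos_cont g" and \<psi>: "continuous_on usphere \<psi>" and u: "u \<in> usphere"
  obtains v where "v \<in> usphere" "weight (\<lambda>v. g v * exp (- t * \<psi> v)) u \<le> weight g u * exp (p * (t * \<psi> v))"
    "wulff_gauge (\<lambda>v. g v * exp (- t * \<psi> v)) u = (u \<bullet> v) / g v * exp (t * \<psi> v)"
proof -
  note gt = pos_cont_mult_exp[OF g \<psi>, of t]
  note h = pos_contD[OF pos_cont_wulff_gauge[OF g] u]
  obtain v where v: "v \<in> usphere" "wulff_gauge (\<lambda>v. g v * exp (- t * \<psi> v)) u = (u \<bullet> v) / (g v * exp (- t * \<psi> v))"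
    by (rule wulff_gauge_attained[OF gt])
  then have eq: "wulff_gauge (\<lambda>v. g v * exp (- t * \<psi> v)) u = (u \<bullet> v) / g v * exp (t * \<psi> v)"
    by (simp add: exp_minus field_simps)
  also have "\<dots> \<le> wulff_gauge g u * exp (t * \<psi> v)"
    by (intro mult_right_mono wulff_gauge_upper[OF g v(1)]) auto
  finally have "wulff_gauge (\<lambda>v. g v * exp (- t * \<psi> v)) u powr p \<le> (wulff_gauge g u * exp (t * \<psi> v)) powr p"
    using pos_contD[OF pos_cont_wulff_gauge[OF gt] u] p by (intro powr_mono2) auto
  then have "wulff_gauge (\<lambda>v. g v * exp (- t * \<psi> v)) u powr p * w u
     \<le> wulff_gauge g u powr p * exp (p * (t * \<psi> v)) * w u"
    unfolding powr_exp_mult[OF h] using pos_contD[OF w u] by (intro mult_right_mono) auto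
  then show thesis
    using that[OF v(1) _ eq] by (simp add: weight_def mult_ac)
qed

text \<open>Minimality compares \<open>g\<close> with \<open>g * exp (- t * \<psi>)\<close> for
  small positive \<open>t\<close>; dividing by \<open>t\<close> and letting it tend to 0 gives one
  inequality.\<close>

lemma first_variation_le:
  assumes g: "pos_cont g" and min: "\<And>f. pos_cont f \<Longrightarrow> energy g \<le> energy f"
    and null: "singular_directions g \<in> null_sets \<sigma>" and \<psi>: "continuous_on usphere \<psi>"
  shows "(\<integral>v. \<psi> v \<partial>\<mu>) \<le> (\<integral>u. weight g u * \<psi> (wulff_normal g u) \<partial>\<sigma>)"
proof -
  have "bounded (\<psi> ` usphere)"
    using compact_continuous_image[OF \<psi> compact_sphere] compact_imp_bounded by blast
  then obtain B where B: "0 < B" "\<And>x. x \<in> usphere \<Longrightarrow> \<bar>\<psi> x\<bar> \<le> B"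
    by (metis bounded_pos imageI real_norm_def)
  \<comment> \<open>The scale keeps \<open>p * t n * \<psi> v\<close> at most 1/2, so the
    denominators \<open>1 - p * t n * \<psi> v\<close> stay at least 1/2.\<close>
  define t where "t n = 1 / (2 * p * B) * (1 / Suc n)" for n
  have t: "0 < t n" "p * t n * B \<le> 1 / 2" for n
  proof -
    show "0 < t n" unfolding t_def using p B(1) by (intro mult_pos_pos divide_pos_pos) auto
    have "p * t n * B = 1 / 2 * (1 / Suc n)" using p B(1) by (simp add: t_def)
    then show "p * t n * B \<le> 1 / 2" by simp
  qed
  have "t \<longlonglongrightarrow> 1 / (2 * p * B) * 0"
    unfolding t_def using LIMSEQ_inverse_real_of_nat by (intro tendsto_intros) (simp add: inverse_eq_divide)
  then have t_lim: "t \<longlonglongrightarrow> 0" by simp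
  define f where "f n = (\<lambda>v. g v * exp (- t n * \<psi> v))" for n
  have f: "pos_cont (f n)" for n unfolding f_def by (rule pos_cont_mult_exp[OF g \<psi>])
  \<comment> \<open>The integrand of the difference quotient of the power term, including the factor
    \<open>1 / p\<close> of the energy.\<close>
  define D where "D n u = (weight (f n) u - weight g u) / (p * t n)" for n u
  have intD: "integrable \<sigma> (D n)" for n
    unfolding D_def by (intro integrable_divide Bochner_Integration.integrable_diff integrable_weight f g)
  have AE: "AE u in \<sigma>. u \<in> usphere - singular_directions g"
    using AE_not_in[OF null] AE_space[of \<sigma>] by eventually_elim (simp only: \<sigma>.space_M, blast)
  \<comment> \<open>This is minimality against \<open>f n\<close>, the logarithmic term being affine
    in \<open>t n\<close>.\<close>
  have diff: "(\<integral>v. \<psi> v \<partial>\<mu>) \<le> (\<integral>u. D n u \<partial>\<sigma>)" for n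
  proof -
    have "(\<integral>v. ln (f n v) \<partial>\<mu>) = (\<integral>v. ln (g v) - t n * \<psi> v \<partial>\<mu>)"
    proof (rule Bochner_Integration.integral_cong)
      fix v assume "v \<in> space \<mu>"
      then have "v \<in> usphere" by (simp only: \<mu>.space_M)
      then show "ln (f n v) = ln (g v) - t n * \<psi> v"
        using pos_contD[OF g \<open>v \<in> usphere\<close>] by (simp add: f_def ln_mult)
    qed simp
    also have "\<dots> = (\<integral>v. ln (g v) \<partial>\<mu>) - t n * (\<integral>v. \<psi> v \<partial>\<mu>)"
      using integrable_ln[OF g] \<mu>.integrable_continuous[OF \<psi>] by (subst Bochner_Integration.integral_diff) auto
    finally have "t n * (\<integral>v. \<psi> v \<partial>\<mu>) \<le> (\<integral>u. weight (f n) u \<partial>\<sigma>) / p - (\<integral>u. weight g u \<partial>\<sigma>) / p"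
      using min[OF f[of n]] by (simp add: energy_def weight_def)
    also have "\<dots> = t n * (\<integral>u. D n u \<partial>\<sigma>)"
      unfolding D_def using t(1)[of n] p integrable_weight[OF f] integrable_weight[OF g]
      by (simp add: Bochner_Integration.integral_diff field_simps)
    finally show ?thesis using t(1)[of n] by simp
  qed
  have D_ge: "weight g u * \<psi> (wulff_normal g u) \<le> D n u" if u: "u \<in> usphere - singular_directions g" for n u
  proof -
    have "weight g u * (1 + p * (t n * \<psi> (wulff_normal g u))) \<le> weight g u * exp (p * (t n * \<psi> (wulff_normal g u)))"
      using weight_nonneg u exp_ge_add_one_self by (intro mult_left_mono) auto
    also have "\<dots> \<le> weight (f n) u"
      unfolding f_def by (rule weight_mult_exp_ge[OF g \<psi> u])
    finally show ?thesis
      using p t(1)[of n] by (simp add: D_def field_simps)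
  qed
  have D_le: "\<exists>v\<in>usphere. D n u \<le> weight g u * (\<psi> v / (1 - p * t n * \<psi> v)) \<and>
      wulff_gauge (\<lambda>x. g x * exp (- t n * \<psi> x)) u = (u \<bullet> v) / g v * exp (t n * \<psi> v)"
    if u: "u \<in> usphere" for n u
  proof -
    obtain v where v: "v \<in> usphere" "weight (f n) u \<le> weight g u * exp (p * (t n * \<psi> v))"
      "wulff_gauge (\<lambda>x. g x * exp (- t n * \<psi> x)) u = (u \<bullet> v) / g v * exp (t n * \<psi> v)"
      unfolding f_def by (rule weight_mult_exp_le[OF g \<psi> u])
    have "p * t n * \<psi> v \<le> p * t n * B"
      using B(2)[OF v(1)] p t(1)[of n] by (intro mult_left_mono) auto
    then have lt: "p * t n * \<psi> v < 1" using t(2)[of n] by linarith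
    have "weight g u * exp (p * (t n * \<psi> v)) \<le> weight g u * (1 + (p * t n * \<psi> v) / (1 - p * t n * \<psi> v))"
      using exp_le_one_plus_quotient[OF lt] weight_nonneg[OF u] by (intro mult_left_mono) (auto simp: mult_ac)
    then have "weight (f n) u - weight g u \<le> weight g u * (\<psi> v / (1 - p * t n * \<psi> v)) * (p * t n)"
      using v(2) by (simp add: algebra_simps)
    then have "D n u \<le> weight g u * (\<psi> v / (1 - p * t n * \<psi> v))"
      using p t(1)[of n] by (simp add: D_def pos_divide_le_eq)
    then show ?thesis using v by blast
  qed
  have "(\<lambda>n. \<integral>u. D n u \<partial>\<sigma>) \<longlonglongrightarrow> (\<integral>u. weight g u * \<psi> (wulff_normal g u) \<partial>\<sigma>)"
  proof (rule integral_dominated_convergence)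
    have "\<psi> \<in> borel_measurable (restrict_space borel usphere)"
      by (rule borel_measurable_continuous_on_restrict[OF \<psi>])
    then have "(\<lambda>u. \<psi> (wulff_normal g u)) \<in> borel_measurable \<sigma>"
      using \<sigma>.measurable_wulff_normal[OF g] by (rule measurable_compose[rotated])
    then show "(\<lambda>u. weight g u * \<psi> (wulff_normal g u)) \<in> borel_measurable \<sigma>"
      using integrable_weight[OF g] by (intro borel_measurable_times) auto
    show "integrable \<sigma> (\<lambda>u. weight g u * (2 * B))" using integrable_weight[OF g] by simp
    \<comment> \<open>\<open>D n u\<close> is squeezed between the limit itself and an upper bound
      evaluated at maximizers of the perturbed gauges, which converges by
      \<open>maximizers_tendsto\<close>.\<close>
    show "AE u in \<sigma>. (\<lambda>n. D n u) \<longlonglongrightarrow> weight g u * \<psi> (wulff_normal g u)"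
      using AE
    proof eventually_elim
      fix u assume u: "u \<in> usphere - singular_directions g"
      then have u': "u \<in> usphere" by simp
      have "\<forall>n. \<exists>v. v \<in> usphere \<and> D n u \<le> weight g u * (\<psi> v / (1 - p * t n * \<psi> v)) \<and>
          wulff_gauge (\<lambda>x. g x * exp (- t n * \<psi> x)) u = (u \<bullet> v) / g v * exp (t n * \<psi> v)"
        using D_le[OF u'] by blast
      from choice[OF this] obtain v where
        "\<forall>n. v n \<in> usphere \<and> D n u \<le> weight g u * (\<psi> (v n) / (1 - p * t n * \<psi> (v n))) \<and>
          wulff_gauge (\<lambda>x. g x * exp (- t n * \<psi> x)) u = (u \<bullet> v n) / g (v n) * exp (t n * \<psi> (v n))" ..
      then have v: "\<And>n. v n \<in> usphere" "\<And>n. D n u \<le> weight g u * (\<psi> (v n) / (1 - p * t n * \<psi> (v n)))"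
        "\<And>n. wulff_gauge (\<lambda>x. g x * exp (- t n * \<psi> x)) u = (u \<bullet> v n) / g (v n) * exp (t n * \<psi> (v n))"
        by blast+
      have "(\<lambda>n. \<psi> (v n)) \<longlonglongrightarrow> \<psi> (wulff_normal g u)"
        by (rule maximizers_tendsto[OF g \<psi> u t_lim t(1) v(1,3) B(2)])
      then have "(\<lambda>n. weight g u * (\<psi> (v n) / (1 - p * t n * \<psi> (v n))))
        \<longlonglongrightarrow> weight g u * (\<psi> (wulff_normal g u) / (1 - p * 0 * \<psi> (wulff_normal g u)))"
        by (intro tendsto_intros t_lim) auto
      then have lim: "(\<lambda>n. weight g u * (\<psi> (v n) / (1 - p * t n * \<psi> (v n))))
        \<longlonglongrightarrow> weight g u * \<psi> (wulff_normal g u)" by simp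
      show "(\<lambda>n. D n u) \<longlonglongrightarrow> weight g u * \<psi> (wulff_normal g u)"
      proof (rule tendsto_sandwich[OF _ _ tendsto_const lim])
        show "\<forall>\<^sub>F n in sequentially. weight g u * \<psi> (wulff_normal g u) \<le> D n u"
          by (intro always_eventually allI D_ge[OF u])
        show "\<forall>\<^sub>F n in sequentially. D n u \<le> weight g u * (\<psi> (v n) / (1 - p * t n * \<psi> (v n)))"
          by (intro always_eventually allI v(2))
      qed
    qed
    fix n
    show "AE u in \<sigma>. norm (D n u) \<le> weight g u * (2 * B)"
      using AE
    proof eventually_elim
      fix u assume u: "u \<in> usphere - singular_directions g"
      then have u': "u \<in> usphere" by simp
      obtain v where v: "v \<in> usphere" "D n u \<le> weight g u * (\<psi> v / (1 - p * t n * \<psi> v))"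
        using D_le[OF u'] by blast
      have "p * t n * \<psi> v \<le> p * t n * B"
        using B(2)[OF v(1)] p t(1)[of n] by (intro mult_left_mono) auto
      then have "1 / 2 \<le> 1 - p * t n * \<psi> v" using t(2)[of n] by linarith
      then have "\<psi> v / (1 - p * t n * \<psi> v) \<le> B / (1 / 2)"
        using B(2)[OF v(1)] B(1) by (intro frac_le) auto
      then have "weight g u * (\<psi> v / (1 - p * t n * \<psi> v)) \<le> weight g u * (B / (1 / 2))"
        using weight_nonneg[OF u'] by (rule mult_left_mono)
      then have "D n u \<le> weight g u * (2 * B)"
        using v(2) by (simp add: mult_ac)
      moreover have "weight g u * (- (2 * B)) \<le> weight g u * \<psi> (wulff_normal g u)"
        using weight_nonneg[OF u', of g] B(1) B(2)[OF wulff_normal_in_usphere[OF g, of u]]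
        by (intro mult_left_mono) auto
      ultimately show "norm (D n u) \<le> weight g u * (2 * B)"
        using D_ge[OF u, of n] by (simp add: abs_le_iff)
    qed
  qed (use intD in auto)
  then show ?thesis
    using diff by (intro LIMSEQ_le_const) auto
qed

text \<open>The reverse inequality is the same one for \<open>- \<psi>\<close>.\<close>

lemma first_variation:
  assumes g: "pos_cont g" and min: "\<And>f. pos_cont f \<Longrightarrow> energy g \<le> energy f"
    and null: "singular_directions g \<in> null_sets \<sigma>" and \<psi>: "continuous_on usphere \<psi>"
  shows "(\<integral>u. weight g u * \<psi> (wulff_normal g u) \<partial>\<sigma>) = (\<integral>v. \<psi> v \<partial>\<mu>)"
  using first_variation_le[OF g min null \<psi>] first_variation_le[OF g min null, of "\<lambda>v. - \<psi> v"] \<psi>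
  by (simp add: continuous_on_minus)

end

section \<open>Wulff shapes as convex bodies\<close>

text \<open>For positive continuous \<open>g\<close> this is the Wulff shape: the gauge is at most 1
  exactly when \<open>x \<bullet> v \<le> g v\<close> for all unit vectors \<open>v\<close>.\<close>

definition wulff_body :: "('a::euclidean_space \<Rightarrow> real) \<Rightarrow> 'a set" where
  "wulff_body g = {x. wulff_gauge g x \<le> 1}"

lemma closed_wulff_body: "pos_cont g \<Longrightarrow> closed (wulff_body g)"
  unfolding wulff_body_def by (intro closed_Collect_le continuous_on_wulff_gauge continuous_intros)

lemma zero_in_interior_wulff_body:
  assumes g: "pos_cont g"
  shows "0 \<in> interior (wulff_body g)"
proof -
  obtain a where a: "0 < a" "\<And>u. u \<in> usphere \<Longrightarrow> a \<le> g u"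
    using pos_cont_lower[OF g] by metis
  have "wulff_gauge g x \<le> 1" if "x \<in> ball 0 a" for x
  proof -
    have "norm x / a \<le> 1" using that a(1) by simp
    then show ?thesis using wulff_gauge_le[OF g a(1), of x] a(2) by fastforce
  qed
  then have "ball 0 a \<subseteq> wulff_body g" by (auto simp: wulff_body_def)
  then show ?thesis using a(1) by (meson centre_in_ball interiorI open_ball)
qed

lemma convex_body_wulff_body:
  assumes g: "pos_cont g"
  shows "convex_body (wulff_body g)"
proof -
  obtain b where b: "0 < b" "\<And>u. u \<in> usphere \<Longrightarrow> g u \<le> b"
    using pos_cont_upper[OF g] by metis
  have "norm x \<le> b" if "x \<in> wulff_body g" for x
  proof -
    have "norm x / b \<le> wulff_gauge g x" by (rule wulff_gauge_ge[OF g b(2)])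
    then have "norm x / b \<le> 1" using that by (simp add: wulff_body_def)
    then show ?thesis using b(1) by simp
  qed
  then have "compact (wulff_body g)"
    using closed_wulff_body[OF g] by (auto simp: compact_eq_bounded_closed bounded_iff)
  moreover have "convex (wulff_body g)"
  proof (rule convexI)
    fix x y and s t :: real
    assume xy: "x \<in> wulff_body g" "y \<in> wulff_body g" and st: "0 \<le> s" "0 \<le> t" "s + t = 1"
    have "wulff_gauge g (s *\<^sub>R x + t *\<^sub>R y) \<le> s * wulff_gauge g x + t * wulff_gauge g y"
      using wulff_gauge_triangle[OF g] st by (metis wulff_gauge_scale[OF g])
    also have "\<dots> \<le> s * 1 + t * 1"
      using xy st by (intro add_mono mult_left_mono) (auto simp: wulff_body_def)
    finally show "s *\<^sub>R x + t *\<^sub>R y \<in> wulff_body g" using st by (simp add: wulff_body_def)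
  qed
  ultimately show ?thesis
    using zero_in_interior_wulff_body[OF g] by (auto simp: convex_body_def)
qed

lemma scale_in_wulff_body_iff:
  assumes g: "pos_cont g" and u: "u \<in> usphere" and "0 \<le> t"
  shows "t *\<^sub>R u \<in> wulff_body g \<longleftrightarrow> t \<le> 1 / wulff_gauge g u"
  using assms(3) pos_contD[OF pos_cont_wulff_gauge[OF g] u]
  by (simp add: wulff_body_def wulff_gauge_scale[OF g] field_simps)

lemma scale_in_wulff_bodyD:
  assumes g: "pos_cont g" and u: "u \<in> usphere" and t: "t *\<^sub>R u \<in> wulff_body g"
  shows "t \<le> 1 / wulff_gauge g u"
proof (cases "0 \<le> t")
  case True
  then show ?thesis using scale_in_wulff_body_iff[OF g u] t by blast
next
  case False
  then have "t < 0" "0 \<le> 1 / wulff_gauge g u"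
    using pos_contD[OF pos_cont_wulff_gauge[OF g] u] by auto
  then show ?thesis by linarith
qed

lemma radial_fun_wulff_body:
  assumes g: "pos_cont g" and u: "u \<in> usphere"
  shows "radial_fun (wulff_body g) u = 1 / wulff_gauge g u"
  unfolding radial_fun_def
proof (rule Greatest_equality)
  show "(1 / wulff_gauge g u) *\<^sub>R u \<in> wulff_body g"
    using scale_in_wulff_body_iff[OF g u, of "1 / wulff_gauge g u"]
      pos_contD[OF pos_cont_wulff_gauge[OF g] u] by simp
qed (rule scale_in_wulff_bodyD[OF g u])

lemma radial_point_in_frontier:
  assumes K: "compact K" and "u \<in> usphere"
    and max: "t *\<^sub>R u \<in> K" "\<And>s. s *\<^sub>R u \<in> K \<Longrightarrow> s \<le> t"
  shows "t *\<^sub>R u \<in> frontier K"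
proof -
  have "t *\<^sub>R u \<notin> interior K"
  proof
    assume "t *\<^sub>R u \<in> interior K"
    then obtain e where e: "0 < e" "cball (t *\<^sub>R u) e \<subseteq> K"
      by (meson mem_interior_cball)
    have "(t + e) *\<^sub>R u \<in> cball (t *\<^sub>R u) e"
      using e(1) assms(2) by (simp add: dist_norm algebra_simps)
    then show False using e max(2) by fastforce
  qed
  then show ?thesis
    using K max(1) by (simp add: frontier_def compact_imp_closed)
qed

lemma radial_fun_wulff_body_frontier:
  assumes g: "pos_cont g" and u: "u \<in> usphere"
  shows "radial_fun (wulff_body g) u *\<^sub>R u \<in> frontier (wulff_body g)"
proof (rule radial_point_in_frontier[OF _ u])
  note h = pos_contD[OF pos_cont_wulff_gauge[OF g] u]
  show "compact (wulff_body g)" using convex_body_wulff_body[OF g] by (simp add: convex_body_def)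
  show "radial_fun (wulff_body g) u *\<^sub>R u \<in> wulff_body g"
    using scale_in_wulff_body_iff[OF g u, of "1 / wulff_gauge g u"] h
    by (simp add: radial_fun_wulff_body[OF g u])
  show "s \<le> radial_fun (wulff_body g) u" if "s *\<^sub>R u \<in> wulff_body g" for s
    using scale_in_wulff_bodyD[OF g u that] by (simp add: radial_fun_wulff_body[OF g u])
qed

lemma outer_unit_normal_wulff_body_maximizer:
  assumes g: "pos_cont g" and v: "v \<in> usphere" "wulff_gauge g u = (u \<bullet> v) / g v" and u: "u \<in> usphere"
  shows "outer_unit_normal (wulff_body g) ((1 / wulff_gauge g u) *\<^sub>R u) v"
proof -
  note pos = pos_contD[OF pos_cont_wulff_gauge[OF g] u] pos_contD[OF g v(1)]
  have "y \<bullet> v \<le> g v" if "y \<in> wulff_body g" for y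
  proof -
    have "(y \<bullet> v) / g v \<le> 1"
      using wulff_gauge_upper[OF g v(1), of y] that by (simp add: wulff_body_def)
    then show ?thesis using pos by simp
  qed
  moreover have "((1 / wulff_gauge g u) *\<^sub>R u) \<bullet> v = g v"
    using v(2) pos by (auto simp: field_simps)
  ultimately show ?thesis using v(1) by (simp add: outer_unit_normal_def)
qed

text \<open>The functional \<open>y \<bullet> v\<close>, normalized to take the value 1 at the
  boundary point, is at most 1 on the body and hence at most the gauge everywhere; homogeneity gives
  equality at \<open>u\<close>.\<close>

lemma outer_unit_normal_wulff_body_subgradient:
  assumes g: "pos_cont g" and u: "u \<in> usphere"
    and out: "outer_unit_normal (wulff_body g) ((1 / wulff_gauge g u) *\<^sub>R u) v"
  obtains c where "0 < c" "wulff_subgradient g u (c *\<^sub>R v)"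
proof -
  note h = pos_contD[OF pos_cont_wulff_gauge[OF g] u]
  define x where "x = (1 / wulff_gauge g u) *\<^sub>R u"
  have v: "norm v = 1" "\<And>y. y \<in> wulff_body g \<Longrightarrow> y \<bullet> v \<le> x \<bullet> v"
    using out by (auto simp: outer_unit_normal_def x_def)
  have scale: "(1 / wulff_gauge g y) *\<^sub>R y \<in> wulff_body g" if "y \<noteq> 0" for y
    using wulff_gauge_pos[OF g that] by (simp add: wulff_body_def wulff_gauge_scale[OF g])
  have v0: "v \<noteq> 0" using v(1) by auto
  \<comment> \<open>The body contains a positive multiple of \<open>v\<close>, so
    \<open>x \<bullet> v\<close> is positive and can serve as divisor.\<close>
  have "0 < 1 / wulff_gauge g v * (v \<bullet> v)"
    using wulff_gauge_pos[OF g v0] v0 by simp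
  also have "\<dots> \<le> x \<bullet> v" using v(2)[OF scale[OF v0]] by simp
  finally have xv: "0 < x \<bullet> v" .
  show thesis
  proof (rule that[of "1 / (x \<bullet> v)"])
    have "y \<bullet> v / (x \<bullet> v) \<le> wulff_gauge g y" for y
    proof (cases "y = 0")
      case False
      then have "(y \<bullet> v) / wulff_gauge g y \<le> x \<bullet> v" using v(2)[OF scale[OF False]] by simp
      then show ?thesis using wulff_gauge_pos[OF g False] xv by (simp add: field_simps)
    qed (use g in simp)
    moreover have "(u \<bullet> v) / (x \<bullet> v) = wulff_gauge g u"
      using xv h by (auto simp: x_def field_simps)
    ultimately show "wulff_subgradient g u ((1 / (x \<bullet> v)) *\<^sub>R v)"
      by (simp add: wulff_subgradient_def inner_commute)
  qed (use xv in simp)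
qed

text \<open>At a regular direction the boundary point has exactly one outer unit normal, namely the
  maximizer in the gauge.\<close>

lemma reverse_radial_gauss_image_wulff_body:
  assumes g: "pos_cont g" and u: "u \<in> usphere - singular_directions g"
  shows "u \<in> reverse_radial_gauss_image (wulff_body g) \<eta> \<longleftrightarrow> wulff_normal g u \<in> \<eta>"
proof
  have u': "u \<in> usphere" using u by simp
  assume "u \<in> reverse_radial_gauss_image (wulff_body g) \<eta>"
  then obtain v where v: "v \<in> \<eta>" "outer_unit_normal (wulff_body g) ((1 / wulff_gauge g u) *\<^sub>R u) v"
    by (auto simp: reverse_radial_gauss_image_def reverse_gauss_image_def radial_fun_wulff_body[OF g u'])
  then have "v \<in> usphere" by (simp add: outer_unit_normal_def)
  then show "wulff_normal g u \<in> \<eta>"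
    using outer_unit_normal_wulff_body_subgradient[OF g u' v(2)] wulff_normal_unique[OF g u] v(1) by metis
next
  have u': "u \<in> usphere" using u by simp
  assume "wulff_normal g u \<in> \<eta>"
  then show "u \<in> reverse_radial_gauss_image (wulff_body g) \<eta>"
    using outer_unit_normal_wulff_body_maximizer[OF g wulff_normal_in_usphere[OF g]
        wulff_gauge_wulff_normal[OF g u] u'] radial_fun_wulff_body_frontier[OF g u'] u'
    by (auto simp: reverse_radial_gauss_image_def reverse_gauss_image_def radial_fun_wulff_body[OF g u'])
qed

section \<open>Dual curvature measures\<close>

context wulff_energy
begin

text \<open>By the first variation, the image under the normal map of \<open>\<sigma>\<close> with
  density \<open>weight g\<close> gives every continuous function the same integral as
  \<open>\<mu>\<close> does.\<close>

lemma emeasure_minimizer: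
  assumes g: "pos_cont g" and min: "\<And>f. pos_cont f \<Longrightarrow> energy g \<le> energy f"
    and null: "singular_directions g \<in> null_sets \<sigma>" and \<eta>: "\<eta> \<in> sets \<mu>"
  shows "emeasure \<mu> \<eta> = (\<integral>\<^sup>+u. ennreal (weight g u) * indicator \<eta> (wulff_normal g u) \<partial>\<sigma>)"
proof -
  let ?S = "restrict_space borel usphere :: 'a measure"
  define D where "D = density \<sigma> (\<lambda>u. ennreal (weight g u))"
  define \<nu> where "\<nu> = distr D ?S (wulff_normal g)"
  have N: "wulff_normal g \<in> D \<rightarrow>\<^sub>M ?S"
    using \<sigma>.measurable_wulff_normal[OF g] by (simp add: D_def)
  have wm: "weight g \<in> borel_measurable \<sigma>"
    using integrable_weight[OF g] by (rule borel_measurable_integrable)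
  have w0: "AE u in \<sigma>. 0 \<le> weight g u"
    by (rule AE_I2) (metis \<sigma>.space_M weight_nonneg)
  have "emeasure D (space D) = (\<integral>\<^sup>+u. ennreal (weight g u) \<partial>\<sigma>)"
    unfolding D_def using wm by (subst emeasure_density) (auto intro!: nn_integral_cong)
  also have "\<dots> < \<infinity>"
    using integrable_weight[OF g] w0 by (simp add: nn_integral_eq_integral)
  finally have "finite_measure D" by (intro finite_measureI) simp
  then have "finite_measure \<nu>" unfolding \<nu>_def using N by (rule finite_measure.finite_measure_distr)
  then have \<nu>: "usphere_measure \<nu>"
    by (intro usphere_measure.intro usphere_measure_axioms.intro) (simp_all add: \<nu>_def)
  have "\<nu> = \<mu>"
  proof (rule usphere_measure_eqI[OF \<nu> \<mu>.usphere_measure_axioms])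
    fix \<psi> :: "'a \<Rightarrow> real" assume \<psi>: "continuous_on usphere \<psi>"
    have \<psi>m: "\<psi> \<in> borel_measurable ?S"
      by (rule borel_measurable_continuous_on_restrict[OF \<psi>])
    have "(\<integral>v. \<psi> v \<partial>\<nu>) = (\<integral>u. \<psi> (wulff_normal g u) \<partial>D)"
      unfolding \<nu>_def by (rule integral_distr[OF N \<psi>m])
    also have "\<dots> = (\<integral>u. weight g u * \<psi> (wulff_normal g u) \<partial>\<sigma>)"
      unfolding D_def using measurable_compose[OF \<sigma>.measurable_wulff_normal[OF g] \<psi>m] wm w0
      by (subst integral_density) auto
    also have "\<dots> = (\<integral>v. \<psi> v \<partial>\<mu>)" by (rule first_variation[OF g min null \<psi>])
    finally show "(\<integral>v. \<psi> v \<partial>\<nu>) = (\<integral>v. \<psi> v \<partial>\<mu>)" .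
  qed
  then have "emeasure \<mu> \<eta> = emeasure \<nu> \<eta>" by simp
  also have "\<dots> = emeasure D (wulff_normal g -` \<eta> \<inter> space D)"
    unfolding \<nu>_def using N \<eta> by (simp add: emeasure_distr \<mu>.sets_M)
  also have "\<dots> = (\<integral>\<^sup>+u. ennreal (weight g u) * indicator (wulff_normal g -` \<eta> \<inter> space D) u \<partial>\<sigma>)"
  proof -
    have "wulff_normal g -` \<eta> \<inter> space D \<in> sets D"
      using N \<eta> by (intro measurable_sets[OF N]) (simp add: \<mu>.sets_M)
    then show ?thesis unfolding D_def using wm by (subst emeasure_density) auto
  qed
  also have "\<dots> = (\<integral>\<^sup>+u. ennreal (weight g u) * indicator \<eta> (wulff_normal g u) \<partial>\<sigma>)"
    by (rule nn_integral_cong) (simp add: D_def indicator_def)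
  finally show ?thesis .
qed

end

section \<open>Sufficiency: realizing a given measure\<close>

lemma pos_cont_radial_fun: "star_body Q \<Longrightarrow> pos_cont (radial_fun Q)"
  by (auto simp: star_body_def pos_cont_def)

lemma pos_cont_powr: "pos_cont f \<Longrightarrow> pos_cont (\<lambda>u. f u powr s)"
  by (auto simp: pos_cont_def intro!: continuous_intros dest: less_imp_neq)

text \<open>The radial function of the Wulff shape is the reciprocal of the gauge, so with exponent
  \<open>- q\<close> the weight of the minimizer becomes the density in the dual curvature
  measure.\<close>

lemma exists_body_with_dual_curvature_measure:
  fixes Q :: "'a::euclidean_space set"
  assumes q: "q < 0" and Q: "star_body Q" and \<mu>: "usphere_measure \<mu>"
    and spread: "\<not> (\<exists>v\<in>usphere. concentrated_in \<mu> (closed_hemisphere v))"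
  obtains K where "convex_body K" "0 \<in> interior K"
    "\<And>\<eta>. \<eta> \<in> sets \<mu> \<Longrightarrow> dual_curvature_measure q K Q \<eta> = emeasure \<mu> \<eta>"
proof -
  interpret \<mu>: usphere_measure \<mu> by fact
  define n where "n = real DIM('a)"
  have n: "0 < n" by (simp add: n_def)
  \<comment> \<open>The normalizing factor \<open>1 / n\<close> is absorbed into the weight, which
    produces the factor \<open>n\<close> below.\<close>
  define w where "w u = radial_fun Q u powr (n - q) / n" for u
  have w: "pos_cont w"
    using pos_cont_powr[OF pos_cont_radial_fun[OF Q], of "n - q"] n
    by (auto simp: pos_cont_def w_def intro!: continuous_intros)
  interpret E: wulff_energy sphere_measure \<mu> w "- q"
    by unfold_locales (use q w spread sphere_measure_not_concentrated in auto)
  obtain g where g: "pos_cont g" "\<And>f. pos_cont f \<Longrightarrow> E.energy g \<le> E.energy f"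
    using E.energy_minimizer by blast
  note null = null_sets_singular_directions[OF g(1)]
  show thesis
  proof (rule that[OF convex_body_wulff_body[OF g(1)] zero_in_interior_wulff_body[OF g(1)]])
    fix \<eta> assume \<eta>: "\<eta> \<in> sets \<mu>"
    let ?K = "wulff_body g"
    let ?f = "\<lambda>u. ennreal (E.weight g u) * indicator \<eta> (wulff_normal g u)"
    have "(\<integral>\<^sup>+ u\<in>reverse_radial_gauss_image ?K \<eta>.
        ennreal (radial_fun ?K u powr q * radial_fun Q u powr (n - q)) \<partial>sphere_measure)
      = (\<integral>\<^sup>+ u. ennreal n * ?f u \<partial>sphere_measure)"
    \<comment> \<open>Off the null set of singular directions, membership in the reverse image means
      that the normal lies in \<open>\<eta>\<close>.\<close>
    proof (rule nn_integral_cong_AE)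
      have "AE u in sphere_measure. u \<in> usphere - singular_directions g"
        using AE_not_in[OF null] AE_space[of sphere_measure]
        by eventually_elim (simp only: sphere_measure.space_M, blast)
      then show "AE u in sphere_measure. ennreal (radial_fun ?K u powr q * radial_fun Q u powr (n - q)) *
          indicator (reverse_radial_gauss_image ?K \<eta>) u = ennreal n * ?f u"
      proof eventually_elim
        fix u assume u: "u \<in> usphere - singular_directions g"
        then have u': "u \<in> usphere" by simp
        note h = pos_contD[OF pos_cont_wulff_gauge[OF g(1)] u']
        have "radial_fun ?K u powr q * radial_fun Q u powr (n - q) = n * E.weight g u"
        proof -
          have "(1 / wulff_gauge g u) powr q = wulff_gauge g u powr (- q)"
            using h by (simp add: powr_divide powr_minus_divide)
          then show ?thesis
            using n unfolding radial_fun_wulff_body[OF g(1) u'] E.weight_def w_def by simp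
        qed
        then show "ennreal (radial_fun ?K u powr q * radial_fun Q u powr (n - q)) *
          indicator (reverse_radial_gauss_image ?K \<eta>) u = ennreal n * ?f u"
          using reverse_radial_gauss_image_wulff_body[OF g(1) u, of \<eta>] n E.weight_nonneg[OF u', of g]
          by (simp add: indicator_def ennreal_mult)
      qed
    qed
    also have "\<dots> = ennreal n * (\<integral>\<^sup>+ u. ?f u \<partial>sphere_measure)"
    proof (rule nn_integral_cmult)
      have "wulff_normal g -` \<eta> \<inter> space sphere_measure \<in> sets sphere_measure"
        using \<eta> by (intro measurable_sets[OF sphere_measure.measurable_wulff_normal[OF g(1)]]) (simp add: \<mu>.sets_M)
      then have "(\<lambda>u. indicator (wulff_normal g -` \<eta> \<inter> space sphere_measure) u :: ennreal) \<in> borel_measurable sphere_measure"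
        by (rule borel_measurable_indicator)
      then have "(\<lambda>u. indicator \<eta> (wulff_normal g u) :: ennreal) \<in> borel_measurable sphere_measure"
        by (rule measurable_cong[THEN iffD1, rotated]) (simp add: indicator_def)
      then show "?f \<in> borel_measurable sphere_measure"
        using E.integrable_weight[OF g(1)] by (intro borel_measurable_times_ennreal measurable_compose[OF _ measurable_ennreal]) auto
    qed
    also have "(\<integral>\<^sup>+ u. ?f u \<partial>sphere_measure) = emeasure \<mu> \<eta>"
      using E.emeasure_minimizer[OF g null \<eta>] by simp
    \<comment> \<open>Passing from the completion to the measure itself leaves the integral of every
      nonnegative function unchanged, measurable or not.\<close>
    finally have "dual_curvature_measure q ?K Q \<eta> = ennreal (1 / n) * (ennreal n * emeasure \<mu> \<eta>)"
      unfolding dual_curvature_measure_def nn_integral_completion n_def[symmetric] by simp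
    also have "\<dots> = emeasure \<mu> \<eta>"
      using n by (simp add: mult.assoc[symmetric] ennreal_mult[symmetric])
    finally show "dual_curvature_measure q ?K Q \<eta> = emeasure \<mu> \<eta>" .
  qed
qed

section \<open>Necessity: positive mass of open hemispheres\<close>

lemma radial_fun_in:
  assumes K: "compact K" and u: "u \<in> usphere" and r: "cball 0 r \<subseteq> K" "0 \<le> r"
  shows "radial_fun K u *\<^sub>R u \<in> K" "t *\<^sub>R u \<in> K \<Longrightarrow> t \<le> radial_fun K u"
proof -
  let ?T = "{t. t *\<^sub>R u \<in> K}"
  obtain R where R: "\<And>x. x \<in> K \<Longrightarrow> norm x \<le> R"
    using compact_imp_bounded[OF K] by (auto simp: bounded_iff)
  have "closed ((\<lambda>t. t *\<^sub>R u) -` K)"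
    by (intro closed_vimage compact_imp_closed K continuous_intros)
  moreover have "bounded ?T"
    using R u by (fastforce simp: bounded_iff)
  ultimately have "compact ?T" by (simp add: compact_eq_bounded_closed vimage_def)
  moreover have "r \<in> ?T" using r u by auto
  ultimately obtain m where m: "m \<in> ?T" "\<And>t. t \<in> ?T \<Longrightarrow> t \<le> m"
    using compact_attains_sup[of ?T] by blast
  then have "radial_fun K u = m"
    unfolding radial_fun_def by (intro Greatest_equality) auto
  then show "radial_fun K u *\<^sub>R u \<in> K" "t *\<^sub>R u \<in> K \<Longrightarrow> t \<le> radial_fun K u"
    using m by auto
qed

lemma outer_unit_normal_exists:
  assumes K: "convex K" "closed K" "interior K \<noteq> {}" and x: "x \<in> frontier K"
  obtains v where "outer_unit_normal K x v"
proof -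
  have "x \<in> K" "x \<notin> rel_interior K"
    using K x by (auto simp: frontier_def rel_interior_nonempty_interior)
  then obtain a where a: "a \<noteq> 0" "\<And>y. y \<in> K \<Longrightarrow> a \<bullet> x \<le> a \<bullet> y"
    using supporting_hyperplane_rel_boundary[OF K(1)] by metis
  \<comment> \<open>The supporting functional \<open>a\<close> attains its minimum over
    \<open>K\<close> at \<open>x\<close>, hence the minus sign.\<close>
  have "outer_unit_normal K x (- a /\<^sub>R norm a)"
    using a by (auto simp: outer_unit_normal_def inner_commute[of _ a] divide_right_mono)
  then show thesis by (rule that)
qed

text \<open>Normals of a body with \<open>r B \<subseteq> K \<subseteq> R B\<close> deviate from the radial direction by an angle
  bounded away from \<open>\<pi>/2\<close>.\<close>

lemma cap_subset_reverse_radial_gauss_image: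
  assumes K: "convex K" "compact K" and r: "0 < r" "cball 0 r \<subseteq> K" and R: "K \<subseteq> cball 0 R"
  shows "ball (- v) (r / R) \<inter> usphere \<subseteq> reverse_radial_gauss_image K (usphere - closed_hemisphere v)"
proof
  fix u assume "u \<in> ball (- v) (r / R) \<inter> usphere"
  then have u: "u \<in> usphere" "norm (u + v) < r / R"
    by (auto simp: dist_norm norm_minus_commute)
  define \<rho> where "\<rho> = radial_fun K u"
  note rad = radial_fun_in[OF K(2) u(1) r(2) less_imp_le[OF r(1)], folded \<rho>_def]
  have fr: "\<rho> *\<^sub>R u \<in> frontier K"
    by (rule radial_point_in_frontier[OF K(2) u(1) rad])
  have "r *\<^sub>R u \<in> K" by (rule subsetD[OF r(2)]) (use r(1) u(1) in simp)
  then have "r \<le> \<rho>" by (rule rad(2))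
  then have \<rho>: "0 < \<rho>" "\<rho> \<le> R" using r rad(1) R u(1) by auto
  have "ball 0 r \<subseteq> interior K" using r(2) by (intro interior_maximal) auto
  then have "interior K \<noteq> {}" using r(1) by auto
  then obtain x where x: "outer_unit_normal K (\<rho> *\<^sub>R u) x"
    using outer_unit_normal_exists[OF K(1) compact_imp_closed[OF K(2)] _ fr] by metis
  then have nx: "norm x = 1" by (simp add: outer_unit_normal_def)
  \<comment> \<open>The inner ball forces the support value of \<open>K\<close> in the normal
    direction \<open>x\<close> to be at least \<open>r\<close>.\<close>
  have "r *\<^sub>R x \<in> K" using r nx by auto
  then have "r *\<^sub>R x \<bullet> x \<le> \<rho> * (u \<bullet> x)"
    using x by (auto simp: outer_unit_normal_def)
  then have rx: "r \<le> \<rho> * (u \<bullet> x)" using nx by (simp add: dot_square_norm)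
  then have "0 < \<rho> * (u \<bullet> x)" using r(1) by linarith
  then have "0 < u \<bullet> x" using \<rho>(1) by (simp add: zero_less_mult_iff)
  then have "\<rho> * (u \<bullet> x) \<le> R * (u \<bullet> x)" using \<rho>(2) by (intro mult_right_mono) auto
  then have "r / R \<le> u \<bullet> x" using rx \<rho> by (simp add: pos_divide_le_eq mult.commute)
  \<comment> \<open>Since \<open>u \<bullet> x\<close> is at least \<open>r / R\<close> and
    \<open>u + v\<close> is shorter than \<open>r / R\<close>, the product
    \<open>v \<bullet> x\<close> is negative.\<close>
  moreover have "(u + v) \<bullet> x \<le> norm (u + v)"
    using norm_cauchy_schwarz[of "u + v" x] nx by simp
  ultimately have "v \<bullet> x < 0" using u(2) by (simp add: inner_add_left)
  then have "x \<in> usphere - closed_hemisphere v"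
    using nx by (simp add: closed_hemisphere_def inner_commute)
  then show "u \<in> reverse_radial_gauss_image K (usphere - closed_hemisphere v)"
    using u(1) fr x unfolding reverse_radial_gauss_image_def reverse_gauss_image_def \<rho>_def by blast
qed

text \<open>The reverse image contains a cap around \<open>- v\<close> of positive surface measure.
  The integrand is bounded below there: the radial function of \<open>K\<close> is at most
  \<open>R\<close>, and a negative power reverses this bound.\<close>

lemma dual_curvature_measure_open_hemisphere_pos:
  fixes K Q :: "'a::euclidean_space set"
  assumes q: "q < 0" and Q: "star_body Q" and K: "convex_body K" "0 \<in> interior K" and v: "v \<in> usphere"
  shows "0 < dual_curvature_measure q K Q (usphere - closed_hemisphere v)"
proof -
  let ?n = "real DIM('a)"
  let ?I = "reverse_radial_gauss_image K (usphere - closed_hemisphere v)"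
  have Kc: "convex K" "compact K" using K by (auto simp: convex_body_def)
  obtain r where r: "0 < r" "cball 0 r \<subseteq> K" using K(2) by (meson mem_interior_cball)
  obtain R where R: "0 < R" "K \<subseteq> cball 0 R"
    using compact_imp_bounded[OF Kc(2)] by (metis bounded_subset_ballD ball_subset_cball subset_trans)
  obtain m where m: "0 < m" "\<And>u. u \<in> usphere \<Longrightarrow> m \<le> radial_fun Q u powr (?n - q)"
    using pos_cont_lower[OF pos_cont_powr[OF pos_cont_radial_fun[OF Q]]] by metis
  define B where "B = ball (- v) (r / R) \<inter> usphere"
  have B: "B \<subseteq> ?I" unfolding B_def by (rule cap_subset_reverse_radial_gauss_image[OF Kc r R(2)])
  have Bpos: "0 < emeasure sphere_measure B"
    unfolding B_def by (rule emeasure_sphere_measure_open_pos[of _ "- v"]) (use v r R in auto)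
  have le: "R powr q * m \<le> radial_fun K u powr q * radial_fun Q u powr (?n - q)" if u: "u \<in> usphere" for u
  proof (intro mult_mono)
    note rad = radial_fun_in[OF Kc(2) u r(2) less_imp_le[OF r(1)]]
    have "r *\<^sub>R u \<in> K" by (rule subsetD[OF r(2)]) (use r(1) u in simp)
    then have "r \<le> radial_fun K u" by (rule rad(2))
    then have "0 < radial_fun K u" "radial_fun K u \<le> R" using r rad(1) R u by auto
    then show "R powr q \<le> radial_fun K u powr q" using q by (intro powr_mono2') auto
  qed (use m u in auto)
  have "0 < ennreal (R powr q * m) * emeasure sphere_measure B"
    using Bpos R m by (simp add: ennreal_zero_less_mult_iff)
  also have "\<dots> = (\<integral>\<^sup>+ u. ennreal (R powr q * m) * indicator B u \<partial>sphere_measure)"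
    unfolding B_def by (rule nn_integral_cmult_indicator[symmetric]) (intro sphere_measure.sets_borel_Int borel_open open_ball)
  also have "\<dots> \<le> (\<integral>\<^sup>+ u\<in>?I. ennreal (radial_fun K u powr q * radial_fun Q u powr (?n - q)) \<partial>sphere_measure)"
  proof (rule nn_integral_mono)
    fix u assume "u \<in> space (sphere_measure :: 'a measure)"
    then have "u \<in> usphere" by (simp only: sphere_measure.space_M)
    then show "ennreal (R powr q * m) * indicator B u
      \<le> ennreal (radial_fun K u powr q * radial_fun Q u powr (?n - q)) * indicator ?I u"
      using le B by (auto simp: indicator_def intro!: ennreal_leI)
  qed
  finally show ?thesis
    unfolding dual_curvature_measure_def nn_integral_completion
    by (simp add: ennreal_zero_less_mult_iff)
qed

theorem theorem1p4:
  fixes q :: real and Q :: "(real ^ 'n) set" and \<mu> :: "(real ^ 'n) measure"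
  assumes "q < 0"
    and "star_body Q"
    and "finite_measure \<mu>"
    and "sets \<mu> = sets (restrict_space borel (sphere 0 1))"
  shows "(\<exists>K. convex_body K \<and> 0 \<in> interior K \<and>
            (\<forall>\<eta>\<in>sets (restrict_space borel (sphere 0 1)).
               dual_curvature_measure q K Q \<eta> = emeasure \<mu> \<eta>)) \<longleftrightarrow>
         \<not> (\<exists>v\<in>sphere 0 1. concentrated_in \<mu> (closed_hemisphere v))"
    (is "?L \<longleftrightarrow> ?R")
proof
  have \<mu>: "usphere_measure \<mu>"
    using assms(3,4) by (intro usphere_measure.intro usphere_measure_axioms.intro)
  interpret \<mu>: usphere_measure \<mu> by fact
  show ?L if ?R
    using exists_body_with_dual_curvature_measure[OF assms(1,2) \<mu> that] assms(4) by metis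
  show ?R if ?L
  proof
    from that obtain K where K: "convex_body K" "0 \<in> interior K"
      "\<And>\<eta>. \<eta> \<in> sets \<mu> \<Longrightarrow> dual_curvature_measure q K Q \<eta> = emeasure \<mu> \<eta>"
      unfolding assms(4) by blast
    assume "\<exists>v\<in>sphere 0 1. concentrated_in \<mu> (closed_hemisphere v)"
    then obtain v where v: "v \<in> sphere 0 1" "emeasure \<mu> (sphere 0 1 - closed_hemisphere v) = 0"
      by (auto simp: concentrated_in_def)
    have "sphere 0 1 - closed_hemisphere v = {x. v \<bullet> x < 0} \<inter> sphere 0 1"
      by (auto simp: closed_hemisphere_def inner_commute)
    then have "sphere 0 1 - closed_hemisphere v \<in> sets \<mu>"
      using \<mu>.sets_borel_Int[OF borel_open[OF open_halfspace_lt[of v 0]]] by simp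
    then show False
      using dual_curvature_measure_open_hemisphere_pos[OF assms(1,2) K(1,2) v(1)] K(3) v(2) by simp
  qed
qed

end
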